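(* Let $\omega$ be an almost monotone weight on $\mathbb N^2$, and let $\widetilde a:\mathbb H^2\to\mathbb C$ have an $\omega$-absolutely convergent Dirichlet series. (I) If $\widetilde a$ is bounded away from zero on $\mathbb H^2$, then there is an almost monotone weight $\nu$ on $\mathbb N^2$ such that: $\nu$ is constant if and only if $\omega$ is constant; $\nu$ is admissible if and only if $\omega$ is admissible; $1\le\nu\le\omega$ pointwise; and $1/\widetilde a$ has a $\nu$-absolutely convergent Dirichlet series. (II) If $\varphi$ is holomorphic on an open neighbourhood of the closure of the range of $\widetilde a$, then there is an almost monotone weight $\xi$ on $\mathbb N^2$ such that: $\xi$ is constant if and only if $\omega$ is constant; $\xi$ is admissible if and only if $\omega$ is admissible; $1\le\xi\le\omega$ pointwise; and $\varphi\circ\widetilde a$ has a $\xi$-absolutely convergent Dirichlet series.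
   Context: $\mathbb N=\{1,2,\dots\}$; $p_1<p_2<\cdots$ are the primes in increasing order; $\mathbb H=\{z\in\mathbb C:\operatorname{Re}z\ge0\}$. $\mathbb N^2$ is a semigroup under coordinatewise multiplication. A weight on $\mathbb N^2$ is a map $\omega:\mathbb N^2\to[1,\infty)$ with $\omega((m_1,n_1)(m_2,n_2))\le\omega(m_1,n_1)\omega(m_2,n_2)$ for all $(m_1,n_1),(m_2,n_2)$. A weight $\omega$ is admissible if $\lim_{n\to\infty}\omega(l^n,k^n)^{1/n}=1$ for all $(l,k)\in\mathbb N^2$. A weight $\omega$ is almost monotone if either $\omega$ is admissible, or there is $K>0$ such that $\omega(m_1,n_1)\le K\omega(m_2,n_2)$ whenever $(m_1,n_1),(m_2,n_2)\in\mathbb N^2$ and either $m_1\mid m_2$ or $n_1\mid n_2$. For a weight $\omega$, a function $\widetilde a:\mathbb H^2\to\mathbb C$ has an $\omega$-absolutely convergent Dirichlet series if there is $a:\mathbb N^2\to\mathbb C$ with $\sum_{(m,n)\in\mathbb N^2}|a(m,n)|\omega(m,n)<\infty$ and $\widetilde a(s_1,s_2)=\sum_{(m,n)}a(m,n)m^{-s_1}n^{-s_2}$ for all $(s_1,s_2)\in\mathbb H^2$. $\widetilde a$ is bounded away from zero if there is $k>0$ with $|\widetilde a|\ge k$ on $\mathbb H^2$. *)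

theory Defs
  imports "HOL-Analysis.Analysis"
begin

text \<open>The semigroup N^2 (N = {1,2,...}) is represented as the pairs of positive naturals.
  Weights are functions nat \<times> nat \<Rightarrow> real; only their values on N2 matter.\<close>

definition N2 :: "(nat \<times> nat) set" where
  "N2 = {(m, n). 0 < m \<and> 0 < n}"

definition Hplane :: "complex set" where
  "Hplane = {z. 0 \<le> Re z}"

definition is_weight :: "(nat \<times> nat \<Rightarrow> real) \<Rightarrow> bool" where
  "is_weight \<omega> \<longleftrightarrow>
     (\<forall>x\<in>N2. 1 \<le> \<omega> x) \<and>
     (\<forall>m1 n1 m2 n2. (m1, n1) \<in> N2 \<longrightarrow> (m2, n2) \<in> N2 \<longrightarrow>
        \<omega> (m1 * m2, n1 * n2) \<le> \<omega> (m1, n1) * \<omega> (m2, n2))"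

definition admissible_weight :: "(nat \<times> nat \<Rightarrow> real) \<Rightarrow> bool" where
  "admissible_weight \<omega> \<longleftrightarrow> is_weight \<omega> \<and>
     (\<forall>l k. (l, k) \<in> N2 \<longrightarrow>
        (\<lambda>n. \<omega> (l ^ n, k ^ n) powr (1 / real n)) \<longlonglongrightarrow> 1)"

definition almost_monotone_weight :: "(nat \<times> nat \<Rightarrow> real) \<Rightarrow> bool" where
  "almost_monotone_weight \<omega> \<longleftrightarrow> is_weight \<omega> \<and>
     (admissible_weight \<omega> \<or>
      (\<exists>K>0. \<forall>m1 n1 m2 n2. (m1, n1) \<in> N2 \<longrightarrow> (m2, n2) \<in> N2 \<longrightarrow>
          (m1 dvd m2 \<or> n1 dvd n2) \<longrightarrow> \<omega> (m1, n1) \<le> K * \<omega> (m2, n2)))"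

definition constant_weight :: "(nat \<times> nat \<Rightarrow> real) \<Rightarrow> bool" where
  "constant_weight \<omega> \<longleftrightarrow> (\<exists>c. \<forall>x\<in>N2. \<omega> x = c)"

definition has_weighted_dirichlet ::
    "(nat \<times> nat \<Rightarrow> real) \<Rightarrow> (complex \<times> complex \<Rightarrow> complex) \<Rightarrow> bool" where
  "has_weighted_dirichlet \<omega> f \<longleftrightarrow>
     (\<exists>a :: nat \<times> nat \<Rightarrow> complex.
        (\<lambda>x. norm (a x) * \<omega> x) summable_on N2 \<and>
        (\<forall>s1 s2. s1 \<in> Hplane \<longrightarrow> s2 \<in> Hplane \<longrightarrow>
           f (s1, s2) = (\<Sum>\<^sub>\<infinity>(m, n)\<in>N2. a (m, n) * of_nat m powr (- s1) * of_nat n powr (- s2))))"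

end

theory Submission
  imports Defs "HOL-Complex_Analysis.Conformal_Mappings" "HOL-Real_Asymp.Real_Asymp"
begin

text \<open>
  The disjunction \<open>m1 dvd m2 \<or> n1 dvd n2\<close> in the definition of almost monotone weights forces
  boundedness, so every almost monotone weight is admissible and \<open>\<nu> = \<xi> = \<omega>\<close> works. It remains to
  show that \<open>\<phi> \<circ> f\<close> has an \<open>\<omega>\<close>-absolutely convergent Dirichlet series; reciprocals are the case
  \<open>\<phi> v = 1 / v\<close>.

  Following Newman's proof of Wiener's lemma, approximate \<open>f\<close> in the weighted norm by a Dirichlet
  polynomial \<open>P\<close> and expand \<open>\<phi> \<circ> f\<close> as the sum over \<open>n\<close> of the \<open>n\<close>-th Taylor coefficient of \<open>\<phi>\<close>
  at \<open>P\<close> times the \<open>n\<close>-th power of \<open>f - P\<close>. By Bohr's correspondence \<open>P\<close> is a polynomial in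
  finitely many variables, one for each prime in each coordinate. Kronecker's theorem
  together with the minimum modulus principle shows that the values of \<open>P\<close> on the closed unit
  polydisc stay close to the closure of the range of \<open>f\<close>. Hence the Taylor coefficients composed
  with \<open>P\<close> are holomorphic on a slightly larger polydisc, and Cauchy's estimates against the
  subexponential growth of \<open>\<omega>\<close> on powers bound their weighted norms by a geometric sequence.
\<close>

no_notation Infinite_Set_Sum.abs_summable_on (infix "abs'_summable'_on" 50)

section \<open>Admissibility and the weighted algebra\<close>

text \<open>Comparing (m, 1) and (1, n) with (1, 1), where a coordinate equal to 1 divides
  trivially, bounds \<omega> on both axes by \<open>K * \<omega> (1, 1)\<close>. Submultiplicativity
  then bounds \<omega> everywhere, and n-th roots of a bounded sequence of numbers at least 1 tend
  to 1.\<close>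

lemma almost_monotone_weight_imp_admissible:
  assumes "almost_monotone_weight \<omega>"
  shows "admissible_weight \<omega>"
proof (rule ccontr)
  assume neg: "\<not> admissible_weight \<omega>"
  then have w: "is_weight \<omega>"
    and "\<exists>K>0. \<forall>m1 n1 m2 n2. (m1, n1) \<in> N2 \<longrightarrow> (m2, n2) \<in> N2 \<longrightarrow>
          (m1 dvd m2 \<or> n1 dvd n2) \<longrightarrow> \<omega> (m1, n1) \<le> K * \<omega> (m2, n2)"
    using assms by (auto simp: almost_monotone_weight_def)
  then obtain K where K: "K > 0" "\<And>m1 n1 m2 n2. (m1, n1) \<in> N2 \<Longrightarrow> (m2, n2) \<in> N2 \<Longrightarrow>
          (m1 dvd m2 \<or> n1 dvd n2) \<Longrightarrow> \<omega> (m1, n1) \<le> K * \<omega> (m2, n2)"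
    by blast
  define B where "B = (K * \<omega> (1, 1)) * (K * \<omega> (1, 1))"
  have one: "1 \<le> \<omega> x" if "x \<in> N2" for x
    using w that by (auto simp: is_weight_def)
  have bound: "\<omega> (m, n) \<le> B" if "(m, n) \<in> N2" for m n
  proof -
    have mem: "(m, 1) \<in> N2" "(1, n) \<in> N2" "(1, 1) \<in> N2"
      using that by (auto simp: N2_def)
    have "\<omega> (m * 1, 1 * n) \<le> \<omega> (m, 1) * \<omega> (1, n)"
      using w mem unfolding is_weight_def by blast
    also have "\<dots> \<le> B"
      unfolding B_def using K(2)[of m 1 1 1] K(2)[of 1 n 1 1] mem one[of "(m, 1)"] one[of "(1, n)"]
      by (intro mult_mono) (auto intro: order_trans[OF zero_le_one])
    finally show ?thesis by simp
  qed
  have B1: "1 \<le> B"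
    using bound[of 1 1] one[of "(1, 1)"] by (simp add: N2_def)
  have "(\<lambda>n. \<omega> (l ^ n, k ^ n) powr (1 / real n)) \<longlonglongrightarrow> 1" if lk: "(l, k) \<in> N2" for l k
  proof (rule tendsto_sandwich)
    have "(l ^ n, k ^ n) \<in> N2" for n
      using lk by (simp add: N2_def)
    then have *: "1 \<le> \<omega> (l ^ n, k ^ n)" "\<omega> (l ^ n, k ^ n) \<le> B" for n
      using one bound by blast+
    show "\<forall>\<^sub>F n in sequentially. 1 \<le> \<omega> (l ^ n, k ^ n) powr (1 / real n)"
      using * by (intro always_eventually allI ge_one_powr_ge_zero) auto
    show "\<forall>\<^sub>F n in sequentially. \<omega> (l ^ n, k ^ n) powr (1 / real n) \<le> B powr (1 / real n)"
      using * by (intro always_eventually allI powr_mono2) (auto intro: order_trans[OF zero_le_one])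
    have "(\<lambda>n. B powr (1 / real n)) \<longlonglongrightarrow> B powr 0"
      using B1 by (intro tendsto_intros lim_const_over_n) auto
    then show "(\<lambda>n. B powr (1 / real n)) \<longlonglongrightarrow> 1"
      using B1 by simp
  qed auto
  with w neg show False by (auto simp: admissible_weight_def)
qed

section \<open>Characters of N^2\<close>

text \<open>The index comes last so that \<open>dchar s\<close> is at once a character of N^2 and,
  read at the prime generators, the point of the polydisc that Bohr's correspondence attaches to
  \<open>s\<close>.\<close>

definition dchar :: "complex \<times> complex \<Rightarrow> nat \<times> nat \<Rightarrow> complex" where
  "dchar s x = of_nat (fst x) powr (- fst s) * of_nat (snd x) powr (- snd s)"

definition nmul :: "nat \<times> nat \<Rightarrow> nat \<times> nat \<Rightarrow> nat \<times> nat" where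
  "nmul x y = (fst x * fst y, snd x * snd y)"

definition npow :: "nat \<times> nat \<Rightarrow> nat \<Rightarrow> nat \<times> nat" where
  "npow x k = (fst x ^ k, snd x ^ k)"

lemma nmul_in_N2: "x \<in> N2 \<Longrightarrow> y \<in> N2 \<Longrightarrow> nmul x y \<in> N2"
  by (auto simp: N2_def nmul_def)

lemma npow_in_N2: "x \<in> N2 \<Longrightarrow> npow x k \<in> N2"
  by (auto simp: N2_def npow_def)

lemma inj_on_nmul: "y \<in> N2 \<Longrightarrow> inj_on (nmul y) N2"
  by (auto simp: N2_def nmul_def inj_on_def)

lemma weight_nmul: "is_weight \<omega> \<Longrightarrow> x \<in> N2 \<Longrightarrow> y \<in> N2 \<Longrightarrow> \<omega> (nmul x y) \<le> \<omega> x * \<omega> y"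
  by (cases x; cases y) (auto simp: is_weight_def nmul_def)

lemma weight_ge_1: "is_weight \<omega> \<Longrightarrow> x \<in> N2 \<Longrightarrow> 1 \<le> \<omega> x"
  by (auto simp: is_weight_def)

lemma of_nat_mult_powr_complex:
  "(of_nat (m * n) :: complex) powr s = of_nat m powr s * of_nat n powr s"
  using powr_times_real[of "of_nat m" "of_nat n" s] by simp

lemma dchar_nmul: "dchar s (nmul x y) = dchar s x * dchar s y"
  by (simp add: dchar_def nmul_def of_nat_mult_powr_complex del: of_nat_mult)

lemma dchar_one [simp]: "dchar s (1, 1) = 1" "dchar s (Suc 0, Suc 0) = 1"
  by (auto simp: dchar_def)

lemma dchar_npow: "dchar s (npow x k) = dchar s x ^ k"
proof (induction k)
  case (Suc k)
  have "npow x (Suc k) = nmul x (npow x k)"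
    by (simp add: npow_def nmul_def)
  with Suc show ?case by (simp add: dchar_nmul)
qed (simp add: npow_def)

lemma norm_of_nat_powr_le_1:
  assumes "0 \<le> Re s"
  shows "norm ((of_nat n :: complex) powr (- s)) \<le> 1"
proof (cases "n = 0")
  case False
  then have "norm ((of_nat n :: complex) powr (- s)) = real n powr (- Re s)"
    using norm_powr_real_powr[of "of_nat n" "- s"] by simp
  also have "\<dots> \<le> real n powr 0"
    using False assms by (intro powr_mono) auto
  finally show ?thesis using False by simp
qed simp

lemma norm_dchar_le_1: "s \<in> Hplane \<times> Hplane \<Longrightarrow> norm (dchar s x) \<le> 1"
  by (auto simp: dchar_def Hplane_def norm_mult intro!: mult_le_one norm_of_nat_powr_le_1)

section \<open>Weighted Dirichlet series as a normed algebra\<close>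

text \<open>\<open>K\<close> stands in for the weighted l^1 norm of \<open>f\<close>: it bounds the
  norm of some representing coefficient family, and the algebra operations become rules for such
  bounds.\<close>

definition dser_le :: "(nat \<times> nat \<Rightarrow> real) \<Rightarrow> real \<Rightarrow> (complex \<times> complex \<Rightarrow> complex) \<Rightarrow> bool" where
  "dser_le \<omega> K f \<longleftrightarrow>
     (\<exists>a. (\<lambda>x. norm (a x) * \<omega> x) summable_on N2 \<and> (\<Sum>\<^sub>\<infinity>x\<in>N2. norm (a x) * \<omega> x) \<le> K \<and>
        (\<forall>s\<in>Hplane \<times> Hplane. f s = (\<Sum>\<^sub>\<infinity>x\<in>N2. a x * dchar s x)))"

lemma has_weighted_dirichlet_iff: "has_weighted_dirichlet \<omega> f \<longleftrightarrow> (\<exists>K. dser_le \<omega> K f)"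
  unfolding has_weighted_dirichlet_def dser_le_def dchar_def
  by (auto simp: case_prod_unfold mult.assoc)

lemma weighted_summable_imp_abs_summable:
  assumes "is_weight \<omega>" "(\<lambda>x. norm (a x :: complex) * \<omega> x) summable_on N2"
  shows "a abs_summable_on N2"
proof (rule Infinite_Sum.abs_summable_on_comparison_test)
  show "(\<lambda>x. norm (a x) * \<omega> x) abs_summable_on N2"
    by (rule assms(2)[THEN summable_on_iff_abs_summable_on_real[THEN iffD1]])
  show "norm (a x) \<le> norm (norm (a x) * \<omega> x)" if "x \<in> N2" for x
    using weight_ge_1[OF assms(1) that] mult_left_mono[of 1 "\<omega> x" "norm (a x)"] by simp
qed

lemma abs_summable_dchar:
  assumes "a abs_summable_on N2" "s \<in> Hplane \<times> Hplane"
  shows "(\<lambda>x. a x * dchar s x) abs_summable_on N2"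
  by (rule Infinite_Sum.abs_summable_on_comparison_test[OF assms(1)])
     (use norm_dchar_le_1[OF assms(2)] in \<open>auto simp: norm_mult intro!: mult_left_le\<close>)

text \<open>Weights are at least 1 and characters at most 1 in modulus, so the weighted norm
  dominates the sup norm. It also shows later that such bounds are nonnegative.\<close>

lemma norm_dser_le:
  assumes "is_weight \<omega>" "dser_le \<omega> K f" "s \<in> Hplane \<times> Hplane"
  shows "norm (f s) \<le> K"
proof -
  obtain a where a: "(\<lambda>x. norm (a x) * \<omega> x) summable_on N2" "(\<Sum>\<^sub>\<infinity>x\<in>N2. norm (a x) * \<omega> x) \<le> K"
    "f s = (\<Sum>\<^sub>\<infinity>x\<in>N2. a x * dchar s x)"
    using assms unfolding dser_le_def by blast
  have abs: "(\<lambda>x. a x * dchar s x) abs_summable_on N2"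
    by (intro abs_summable_dchar weighted_summable_imp_abs_summable[OF assms(1)] a assms)
  have "norm (f s) \<le> (\<Sum>\<^sub>\<infinity>x\<in>N2. norm (a x * dchar s x))"
    unfolding a(3) by (rule norm_infsum_bound[OF abs])
  also have "\<dots> \<le> (\<Sum>\<^sub>\<infinity>x\<in>N2. norm (a x) * \<omega> x)"
  proof (rule infsum_mono[OF abs a(1)])
    fix x assume "x \<in> N2"
    then show "norm (a x * dchar s x) \<le> norm (a x) * \<omega> x"
      unfolding norm_mult using norm_dchar_le_1[OF assms(3), of x] weight_ge_1[OF assms(1), of x]
      by (intro mult_left_mono) auto
  qed
  finally show ?thesis using a(2) by simp
qed

lemma dser_le_mono: "dser_le \<omega> K f \<Longrightarrow> K \<le> L \<Longrightarrow> dser_le \<omega> L f"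
  by (force simp: dser_le_def)

lemma dser_le_cong:
  "(\<And>s. s \<in> Hplane \<times> Hplane \<Longrightarrow> f s = g s) \<Longrightarrow> dser_le \<omega> K f \<longleftrightarrow> dser_le \<omega> K g"
  by (simp add: dser_le_def)

lemma dser_le_cmult:
  assumes "dser_le \<omega> K f"
  shows "dser_le \<omega> (norm c * K) (\<lambda>s. c * f s)"
proof -
  obtain a where a: "(\<lambda>x. norm (a x) * \<omega> x) summable_on N2" "(\<Sum>\<^sub>\<infinity>x\<in>N2. norm (a x) * \<omega> x) \<le> K"
    "\<And>s. s \<in> Hplane \<times> Hplane \<Longrightarrow> f s = (\<Sum>\<^sub>\<infinity>x\<in>N2. a x * dchar s x)"
    using assms unfolding dser_le_def by blast
  show ?thesis
    unfolding dser_le_def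
  proof (intro exI[of _ "\<lambda>x. c * a x"] conjI ballI)
    show "(\<lambda>x. norm (c * a x) * \<omega> x) summable_on N2"
      using summable_on_cmult_right[OF a(1), of "norm c"] by (simp add: norm_mult mult.assoc)
    show "(\<Sum>\<^sub>\<infinity>x\<in>N2. norm (c * a x) * \<omega> x) \<le> norm c * K"
      using a(2) by (simp add: norm_mult mult.assoc infsum_cmult_right' mult_left_mono)
    show "c * f s = (\<Sum>\<^sub>\<infinity>x\<in>N2. c * a x * dchar s x)" if "s \<in> Hplane \<times> Hplane" for s
      using a(3)[OF that] by (simp add: mult.assoc infsum_cmult_right')
  qed
qed

text \<open>Multiplying by a character shifts the coefficients along the injection
  \<open>nmul y\<close>; submultiplicativity charges a factor of at most
  \<open>\<omega> y\<close>.\<close>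

lemma dser_le_dchar_mult:
  assumes w: "is_weight \<omega>" and "dser_le \<omega> K f" and y: "y \<in> N2"
  shows "dser_le \<omega> (\<omega> y * K) (\<lambda>s. dchar s y * f s)"
proof -
  obtain a where a: "(\<lambda>x. norm (a x) * \<omega> x) summable_on N2" "(\<Sum>\<^sub>\<infinity>x\<in>N2. norm (a x) * \<omega> x) \<le> K"
    "\<And>s. s \<in> Hplane \<times> Hplane \<Longrightarrow> f s = (\<Sum>\<^sub>\<infinity>x\<in>N2. a x * dchar s x)"
    using assms unfolding dser_le_def by blast
  \<comment> \<open>The coefficients pushed forward along \<open>nmul y\<close>, with 0 at pairs
    outside its image.\<close>
  define b where "b z = (if z \<in> nmul y ` N2 then a (inv_into N2 (nmul y) z) else 0)" for z
  have b: "b (nmul y x) = a x" if "x \<in> N2" for x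
    using that inj_on_nmul[OF y] by (simp add: b_def)
  have sub: "nmul y ` N2 \<subseteq> N2" using nmul_in_N2[OF y] by blast
  have b0: "b z = 0" if "z \<in> N2 - nmul y ` N2" for z
    using that by (simp add: b_def)
  have sw: "(\<lambda>x. \<omega> y * (norm (a x) * \<omega> x)) summable_on N2"
    by (rule summable_on_cmult_right[OF a(1)])
  have le: "norm (b (nmul y x)) * \<omega> (nmul y x) \<le> \<omega> y * (norm (a x) * \<omega> x)" if "x \<in> N2" for x
    using mult_left_mono[OF weight_nmul[OF w y that], of "norm (a x)"] b[OF that] by (simp add: mult_ac)
  have pos: "0 \<le> norm (b (nmul y x)) * \<omega> (nmul y x)" if "x \<in> N2" for x
    using weight_ge_1[OF w nmul_in_N2[OF y that]] by simp
  have sb: "(\<lambda>x. norm (b (nmul y x)) * \<omega> (nmul y x)) summable_on N2"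
    using sw le pos by (rule summable_on_comparison_test)
  have red: "(\<lambda>z. g z) summable_on N2 \<longleftrightarrow> (\<lambda>x. g (nmul y x)) summable_on N2"
    "infsum g N2 = (\<Sum>\<^sub>\<infinity>x\<in>N2. g (nmul y x))"
    if "\<And>z. z \<in> N2 - nmul y ` N2 \<Longrightarrow> g z = 0" for g :: "_ \<Rightarrow> 'b :: {comm_monoid_add, t2_space}"
  proof -
    have "g summable_on N2 \<longleftrightarrow> g summable_on (nmul y ` N2)"
      using that sub by (intro summable_on_cong_neutral) auto
    then show "g summable_on N2 \<longleftrightarrow> (\<lambda>x. g (nmul y x)) summable_on N2"
      using summable_on_reindex[OF inj_on_nmul[OF y]] by (simp add: o_def)
    have "infsum g N2 = infsum g (nmul y ` N2)"
      using that sub by (intro infsum_cong_neutral) auto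
    then show "infsum g N2 = (\<Sum>\<^sub>\<infinity>x\<in>N2. g (nmul y x))"
      using infsum_reindex[OF inj_on_nmul[OF y]] by (simp add: o_def)
  qed
  show ?thesis
    unfolding dser_le_def
  proof (intro exI[of _ b] conjI ballI)
    show "(\<lambda>x. norm (b x) * \<omega> x) summable_on N2"
      using sb by (subst red) (auto simp: b0)
    have "(\<Sum>\<^sub>\<infinity>x\<in>N2. norm (b x) * \<omega> x) = (\<Sum>\<^sub>\<infinity>x\<in>N2. norm (b (nmul y x)) * \<omega> (nmul y x))"
      by (rule red) (simp add: b0)
    also have "\<dots> \<le> (\<Sum>\<^sub>\<infinity>x\<in>N2. \<omega> y * (norm (a x) * \<omega> x))"
      using sb sw le by (rule infsum_mono)
    also have "\<dots> \<le> \<omega> y * K"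
      using a(2) weight_ge_1[OF w y] by (simp add: infsum_cmult_right' mult_left_mono)
    finally show "(\<Sum>\<^sub>\<infinity>x\<in>N2. norm (b x) * \<omega> x) \<le> \<omega> y * K" .
    fix s assume s: "s \<in> Hplane \<times> Hplane"
    have "(\<Sum>\<^sub>\<infinity>x\<in>N2. b x * dchar s x) = (\<Sum>\<^sub>\<infinity>x\<in>N2. b (nmul y x) * dchar s (nmul y x))"
      by (rule red) (simp add: b0)
    also have "\<dots> = (\<Sum>\<^sub>\<infinity>x\<in>N2. dchar s y * (a x * dchar s x))"
      by (intro infsum_cong) (simp add: b dchar_nmul mult_ac)
    also have "\<dots> = dchar s y * f s"
      by (simp add: infsum_cmult_right' a(3)[OF s])
    finally show "dchar s y * f s = (\<Sum>\<^sub>\<infinity>x\<in>N2. b x * dchar s x)" ..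
  qed
qed

text \<open>Completeness of the algebra: the coefficient families are added pointwise over
  \<open>J\<close>, and Fubini applies because the double family is absolutely summable. Products
  and Taylor expansions below all rest on this rule.\<close>

lemma dser_le_infsum:
  assumes w: "is_weight \<omega>"
    and f: "\<And>i. i \<in> J \<Longrightarrow> dser_le \<omega> (K i) (f i)"
    and K: "K summable_on J"
  shows "dser_le \<omega> (infsum K J) (\<lambda>s. \<Sum>\<^sub>\<infinity>i\<in>J. f i s)"
proof -
  have "\<exists>a. \<forall>i\<in>J. (\<lambda>x. norm (a i x) * \<omega> x) summable_on N2 \<and>
        (\<Sum>\<^sub>\<infinity>x\<in>N2. norm (a i x) * \<omega> x) \<le> K i \<and>
        (\<forall>s\<in>Hplane \<times> Hplane. f i s = (\<Sum>\<^sub>\<infinity>x\<in>N2. a i x * dchar s x))"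
    using f unfolding dser_le_def by (intro bchoice) blast
  then obtain a where a: "\<And>i. i \<in> J \<Longrightarrow> (\<lambda>x. norm (a i x) * \<omega> x) summable_on N2"
    "\<And>i. i \<in> J \<Longrightarrow> (\<Sum>\<^sub>\<infinity>x\<in>N2. norm (a i x) * \<omega> x) \<le> K i"
    "\<And>i s. i \<in> J \<Longrightarrow> s \<in> Hplane \<times> Hplane \<Longrightarrow> f i s = (\<Sum>\<^sub>\<infinity>x\<in>N2. a i x * dchar s x)"
    by blast
  have w0: "0 \<le> \<omega> x" if "x \<in> N2" for x using weight_ge_1[OF w that] by simp
  have normw: "norm (norm (a i x) * \<omega> x) = norm (a i x) * \<omega> x" if "x \<in> N2" for i x
    using w0[OF that] by simp
  have inner_nonneg: "0 \<le> (\<Sum>\<^sub>\<infinity>x\<in>N2. norm (a i x) * \<omega> x)" for i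
    by (intro infsum_nonneg mult_nonneg_nonneg w0) auto
  have inner_summable: "(\<lambda>i. \<Sum>\<^sub>\<infinity>x\<in>N2. norm (a i x) * \<omega> x) summable_on J"
    using K a(2) inner_nonneg by (rule summable_on_comparison_test)
  have absw: "(\<lambda>(i, x). norm (a i x) * \<omega> x) abs_summable_on (J \<times> N2)"
  proof (subst Infinite_Sum.abs_summable_on_Sigma_iff, intro conjI ballI)
    show "(\<lambda>y. (case (i, y) of (i, x) \<Rightarrow> norm (a i x) * \<omega> x)) abs_summable_on N2" if "i \<in> J" for i
      using a(1)[OF that, THEN summable_on_iff_abs_summable_on_real[THEN iffD1]] by simp
    have "(\<lambda>i. \<Sum>\<^sub>\<infinity>y\<in>N2. norm (case (i, y) of (i, x) \<Rightarrow> norm (a i x) * \<omega> x))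
        = (\<lambda>i. \<Sum>\<^sub>\<infinity>x\<in>N2. norm (a i x) * \<omega> x)"
      by (intro ext infsum_cong) (use normw in simp)
    with inner_summable
    show "(\<lambda>i. \<Sum>\<^sub>\<infinity>y\<in>N2. norm (case (i, y) of (i, x) \<Rightarrow> norm (a i x) * \<omega> x)) abs_summable_on J"
      by (intro summable_on_iff_abs_summable_on_real[THEN iffD1]) simp
  qed
  have sumw: "(\<lambda>(i, x). norm (a i x) * \<omega> x) summable_on (J \<times> N2)"
    using absw by (rule abs_summable_summable)
  have sumw': "(\<lambda>(x, i). norm (a i x) * \<omega> x) summable_on (N2 \<times> J)"
    using sumw by (subst (asm) summable_on_swap) (simp add: case_prod_unfold)
  have absa: "(\<lambda>(i, x). a i x) abs_summable_on (J \<times> N2)"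
  proof (rule Infinite_Sum.abs_summable_on_comparison_test[OF absw])
    show "norm (case z of (i, x) \<Rightarrow> a i x) \<le> norm (case z of (i, x) \<Rightarrow> norm (a i x) * \<omega> x)"
      if "z \<in> J \<times> N2" for z
      using that weight_ge_1[OF w] by (auto simp: abs_mult mult_le_cancel_left1 intro: order_trans[OF _ abs_ge_self])
  qed
  have absx: "(\<lambda>i. a i x) abs_summable_on J" if "x \<in> N2" for x
  proof -
    have "(\<lambda>(x, i). a i x) abs_summable_on (N2 \<times> J)"
      using absa by (subst (asm) summable_on_swap) (simp add: case_prod_unfold)
    then show ?thesis using that by (subst (asm) Infinite_Sum.abs_summable_on_Sigma_iff) auto
  qed
  define A where "A x = (\<Sum>\<^sub>\<infinity>i\<in>J. a i x)" for x
  have normA: "norm (A x) * \<omega> x \<le> (\<Sum>\<^sub>\<infinity>i\<in>J. norm (a i x) * \<omega> x)" if "x \<in> N2" for x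
    using mult_right_mono[OF norm_infsum_bound[OF absx[OF that]] w0[OF that]]
    by (simp add: A_def infsum_cmult_left')
  have sumA': "(\<lambda>x. \<Sum>\<^sub>\<infinity>i\<in>J. norm (a i x) * \<omega> x) summable_on N2"
    using sumw' by (rule summable_on_Sigma_banach)
  have sumA: "(\<lambda>x. norm (A x) * \<omega> x) summable_on N2"
    using sumA' normA by (rule summable_on_comparison_test) (use w0 in auto)
  show ?thesis
    unfolding dser_le_def
  proof (intro exI[of _ A] conjI ballI)
    show "(\<lambda>x. norm (A x) * \<omega> x) summable_on N2" by (rule sumA)
    have "(\<Sum>\<^sub>\<infinity>x\<in>N2. norm (A x) * \<omega> x) \<le> (\<Sum>\<^sub>\<infinity>x\<in>N2. \<Sum>\<^sub>\<infinity>i\<in>J. norm (a i x) * \<omega> x)"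
      using sumA sumA' normA by (rule infsum_mono)
    also have "\<dots> = (\<Sum>\<^sub>\<infinity>i\<in>J. \<Sum>\<^sub>\<infinity>x\<in>N2. norm (a i x) * \<omega> x)"
      using infsum_swap_banach[OF sumw] by simp
    also have "\<dots> \<le> infsum K J"
      using inner_summable K a(2) by (rule infsum_mono)
    finally show "(\<Sum>\<^sub>\<infinity>x\<in>N2. norm (A x) * \<omega> x) \<le> infsum K J" .
    fix s assume s: "s \<in> Hplane \<times> Hplane"
    have "(\<lambda>(i, x). a i x * dchar s x) abs_summable_on (J \<times> N2)"
      by (rule Infinite_Sum.abs_summable_on_comparison_test[OF absa])
         (use norm_dchar_le_1[OF s] in \<open>auto simp: norm_mult intro!: mult_left_le\<close>)
    then have "(\<lambda>(i, x). a i x * dchar s x) summable_on (J \<times> N2)"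
      by (rule abs_summable_summable)
    from infsum_swap_banach[OF this]
    have "(\<Sum>\<^sub>\<infinity>i\<in>J. \<Sum>\<^sub>\<infinity>x\<in>N2. a i x * dchar s x) = (\<Sum>\<^sub>\<infinity>x\<in>N2. A x * dchar s x)"
      by (simp add: A_def infsum_cmult_left')
    then show "(\<Sum>\<^sub>\<infinity>i\<in>J. f i s) = (\<Sum>\<^sub>\<infinity>x\<in>N2. A x * dchar s x)"
      using a(3) s by (simp cong: infsum_cong)
  qed
qed

text \<open>Only \<open>f\<close> is expanded: the product is a sum of multiples of shifts of
  \<open>g\<close>, each controlled by \<open>dser_le_dchar_mult\<close>, which sidesteps an
  explicit Dirichlet convolution.\<close>

lemma dser_le_mult:
  assumes w: "is_weight \<omega>" and f: "dser_le \<omega> K f" and g: "dser_le \<omega> L g"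
  shows "dser_le \<omega> (K * L) (\<lambda>s. f s * g s)"
proof -
  obtain a where a: "(\<lambda>x. norm (a x) * \<omega> x) summable_on N2" "(\<Sum>\<^sub>\<infinity>x\<in>N2. norm (a x) * \<omega> x) \<le> K"
    "\<And>s. s \<in> Hplane \<times> Hplane \<Longrightarrow> f s = (\<Sum>\<^sub>\<infinity>x\<in>N2. a x * dchar s x)"
    using f unfolding dser_le_def by blast
  have "(0, 0) \<in> Hplane \<times> Hplane" by (simp add: Hplane_def)
  from norm_dser_le[OF w g this] have L: "0 \<le> L"
    using norm_ge_zero order_trans by blast
  have "dser_le \<omega> (\<Sum>\<^sub>\<infinity>x\<in>N2. norm (a x) * (\<omega> x * L)) (\<lambda>s. \<Sum>\<^sub>\<infinity>x\<in>N2. a x * (dchar s x * g s))"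
  proof (rule dser_le_infsum[OF w])
    show "dser_le \<omega> (norm (a x) * (\<omega> x * L)) (\<lambda>s. a x * (dchar s x * g s))" if "x \<in> N2" for x
      by (intro dser_le_cmult dser_le_dchar_mult w g that)
    show "(\<lambda>x. norm (a x) * (\<omega> x * L)) summable_on N2"
      using summable_on_cmult_left[OF a(1), of L] by (simp add: mult.assoc)
  qed
  moreover have "(\<Sum>\<^sub>\<infinity>x\<in>N2. norm (a x) * (\<omega> x * L)) = (\<Sum>\<^sub>\<infinity>x\<in>N2. norm (a x) * \<omega> x) * L"
    by (simp flip: mult.assoc add: infsum_cmult_left')
  moreover have "(\<Sum>\<^sub>\<infinity>x\<in>N2. a x * (dchar s x * g s)) = f s * g s" if "s \<in> Hplane \<times> Hplane" for s
    by (simp flip: mult.assoc add: infsum_cmult_left' a(3)[OF that])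
  ultimately have "dser_le \<omega> ((\<Sum>\<^sub>\<infinity>x\<in>N2. norm (a x) * \<omega> x) * L) (\<lambda>s. f s * g s)"
    by (subst dser_le_cong[of _ "\<lambda>s. \<Sum>\<^sub>\<infinity>x\<in>N2. a x * (dchar s x * g s)"]) auto
  then show ?thesis
    by (rule dser_le_mono) (intro mult_right_mono a L)
qed

lemma dser_le_const:
  assumes "is_weight \<omega>"
  shows "dser_le \<omega> (norm c * \<omega> (1, 1)) (\<lambda>s. c)"
proof -
  define a :: "nat \<times> nat \<Rightarrow> complex" where "a x = (if x = (1, 1) then c else 0)" for x
  have mem: "(1, 1) \<in> N2" by (simp add: N2_def)
  have *: "g summable_on N2" "infsum g N2 = g (1, 1)"
    if "\<And>x. x \<noteq> (1, 1) \<Longrightarrow> g x = 0" for g :: "nat \<times> nat \<Rightarrow> 'b :: {comm_monoid_add, t2_space}"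
  proof -
    have "g summable_on N2 \<longleftrightarrow> g summable_on {(1, 1)}"
      using that mem by (intro summable_on_cong_neutral) auto
    then show "g summable_on N2" by simp
    have "infsum g N2 = infsum g {(1, 1)}"
      using that mem by (intro infsum_cong_neutral) auto
    then show "infsum g N2 = g (1, 1)" by simp
  qed
  show ?thesis
    unfolding dser_le_def
    by (intro exI[of _ a] conjI ballI, rule *(1), simp add: a_def, subst *(2), simp add: a_def,
        simp add: a_def, subst *(2), simp_all add: a_def)
qed

text \<open>The factor \<open>\<omega> (1, 1)\<close> comes from the constant 1, the case n = 0: a
  weight may exceed 1 at the unit.\<close>

lemma dser_le_power:
  assumes "is_weight \<omega>" "dser_le \<omega> K f"
  shows "dser_le \<omega> (K ^ n * \<omega> (1, 1)) (\<lambda>s. f s ^ n)"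
proof (induction n)
  case 0
  show ?case using dser_le_const[OF assms(1), of 1] by simp
next
  case (Suc n)
  show ?case using dser_le_mult[OF assms Suc] by (simp add: mult_ac)
qed

section \<open>Separately holomorphic functions on polydiscs\<close>

definition polydisc :: "real \<Rightarrow> ('i \<Rightarrow> complex) set" where
  "polydisc R = {z. \<forall>i. norm (z i) < R}"

text \<open>Only one-variable holomorphy is recorded, and the active coordinates \<open>I\<close>
  are a parameter, so that an induction can remove them one at a time.\<close>

definition sep_holomorphic :: "real \<Rightarrow> 'i set \<Rightarrow> (('i \<Rightarrow> complex) \<Rightarrow> complex) \<Rightarrow> bool" where
  "sep_holomorphic R I F \<longleftrightarrow>
     (\<forall>z\<in>polydisc R. \<forall>i\<in>I. (\<lambda>w. F (z(i := w))) holomorphic_on ball 0 R)"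

definition taylor_coeff :: "(('i \<Rightarrow> complex) \<Rightarrow> complex) \<Rightarrow> 'i \<Rightarrow> nat \<Rightarrow> ('i \<Rightarrow> complex) \<Rightarrow> complex" where
  "taylor_coeff F j n z = (deriv ^^ n) (\<lambda>w. F (z(j := w))) 0 / fact n"

lemma polydisc_upd: "z \<in> polydisc R \<Longrightarrow> norm w < R \<Longrightarrow> z(i := w) \<in> polydisc R"
  by (simp add: polydisc_def)

lemma norm_deriv_coeff_le:
  assumes "h holomorphic_on ball z R" "\<And>w. w \<in> ball z R \<Longrightarrow> norm (h w) \<le> M" "0 < r" "r < R"
  shows "norm ((deriv ^^ n) h z / fact n) \<le> M / r ^ n"
proof -
  have sub: "cball z r \<subseteq> ball z R" using assms by auto
  have "norm ((deriv ^^ n) h z) \<le> fact n * M / r ^ n"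
  proof (rule Cauchy_inequality)
    show "h holomorphic_on ball z r" using assms by (auto intro: holomorphic_on_subset)
    show "continuous_on (cball z r) h"
      using assms(1) sub by (blast intro: holomorphic_on_imp_continuous_on continuous_on_subset)
    show "norm (h x) \<le> M" if "norm (z - x) = r" for x
      using that assms by (intro assms(2)) (simp add: dist_norm)
  qed (use assms in auto)
  then show ?thesis by (simp add: norm_divide field_simps)
qed

text \<open>The tail beyond the n-th term is dominated by a geometric series of ratio at most 1/2.
  The error depends on \<open>h\<close> only through \<open>M\<close>, which makes it uniform in
  parameters.\<close>

lemma power_series_remainder_le:
  assumes "h holomorphic_on ball 0 R" "\<And>w. w \<in> ball 0 R \<Longrightarrow> norm (h w) \<le> M" "0 < r" "r < R"
    and w: "w \<noteq> 0" "norm w \<le> r / 2"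
  defines "c \<equiv> \<lambda>m. (deriv ^^ m) h 0 / fact m"
  shows "norm ((h w - (\<Sum>m<n. c m * w ^ m)) / w ^ n - c n) \<le> 2 * M / r ^ Suc n * norm w"
proof -
  define q where "q = norm w / r"
  have q: "0 \<le> q" "q \<le> 1 / 2" using assms by (auto simp: q_def field_simps)
  have "norm (h 0) \<le> M" using assms(3,4) by (intro assms(2)) auto
  then have "0 \<le> M" by (rule order_trans[OF norm_ge_zero])
  have "(\<lambda>m. c m * w ^ m) sums h w"
    using holomorphic_power_series[OF assms(1), of w] assms by (simp add: c_def)
  then have tail: "(\<lambda>m. c (m + Suc n) * w ^ (m + Suc n)) sums (h w - (\<Sum>m<Suc n. c m * w ^ m))"
    by (rule sums_split_initial_segment)
  have "(\<lambda>m. q ^ m) sums (1 / (1 - q))"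
    using q by (intro geometric_sums) auto
  from sums_mult[OF this, of "M * q ^ Suc n"]
  have geo: "(\<lambda>m. M * q ^ Suc n * q ^ m) sums (M * q ^ Suc n * (1 / (1 - q)))" .
  have "norm (h w - (\<Sum>m<Suc n. c m * w ^ m)) \<le> M * q ^ Suc n * (1 / (1 - q))"
  proof (rule norm_sums_le[OF tail geo])
    fix m
    have "norm (c (m + Suc n) * w ^ (m + Suc n)) \<le> M / r ^ (m + Suc n) * norm w ^ (m + Suc n)"
      unfolding norm_mult norm_power c_def
      by (intro mult_right_mono norm_deriv_coeff_le[OF assms(1,2,3,4)]) auto
    also have "\<dots> = M * q ^ (m + Suc n)"
      by (simp add: q_def power_divide)
    also have "\<dots> = M * q ^ Suc n * q ^ m"
      by (simp only: power_add mult_ac)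
    finally show "norm (c (m + Suc n) * w ^ (m + Suc n)) \<le> M * q ^ Suc n * q ^ m" .
  qed
  also have "\<dots> \<le> M * q ^ Suc n * 2"
    using q \<open>0 \<le> M\<close> by (intro mult_left_mono) (auto simp: field_simps)
  finally have *: "norm (h w - (\<Sum>m<Suc n. c m * w ^ m)) \<le> 2 * M * q ^ Suc n" by simp
  have "(h w - (\<Sum>m<n. c m * w ^ m)) / w ^ n - c n = (h w - (\<Sum>m<Suc n. c m * w ^ m)) / w ^ n"
    using w by (simp add: field_simps)
  then have "norm ((h w - (\<Sum>m<n. c m * w ^ m)) / w ^ n - c n)
      = norm (h w - (\<Sum>m<Suc n. c m * w ^ m)) / norm w ^ n"
    by (simp only: norm_divide norm_power)
  also have "\<dots> \<le> 2 * M * q ^ Suc n / norm w ^ n"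
    using * by (intro divide_right_mono) auto
  also have "\<dots> = 2 * M / r ^ Suc n * norm w"
    using w assms by (simp add: q_def power_divide)
  finally show ?thesis .
qed

lemma sep_holomorphic_slice:
  "sep_holomorphic R I F \<Longrightarrow> z \<in> polydisc R \<Longrightarrow> i \<in> I \<Longrightarrow> (\<lambda>w. F (z(i := w))) holomorphic_on ball 0 R"
  by (simp add: sep_holomorphic_def)

text \<open>Separate holomorphy of a bounded function passes to its Taylor coefficients in one
  variable because each coefficient is a uniform limit of difference quotients built from
  the preceding ones.\<close>

lemma sep_holomorphic_taylor_coeff:
  assumes F: "sep_holomorphic R (insert j I) F" and bound: "\<And>z. z \<in> polydisc R \<Longrightarrow> norm (F z) \<le> M"
    and r: "0 < r" "r < R" and "j \<notin> I"
  shows "sep_holomorphic R I (taylor_coeff F j n)"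
proof (induction n rule: less_induct)
  case (less n)
  show ?case
    unfolding sep_holomorphic_def
  proof (intro ballI)
    fix z :: "'a \<Rightarrow> complex" and i assume z: "z \<in> polydisc R" and i: "i \<in> I"
    then have "i \<noteq> j" using \<open>j \<notin> I\<close> by blast
    \<comment> \<open>These points tend to 0, and the shift by 2 keeps them within
      \<open>r / 2\<close>, the range of the remainder estimate.\<close>
    define w :: "nat \<Rightarrow> complex" where "w k = of_real (r / (real k + 2))" for k
    have norm_w: "norm (w k) = r / (real k + 2)" for k
      unfolding w_def norm_of_real using r by simp
    have w: "w k \<noteq> 0" "norm (w k) \<le> r / 2" "norm (w k) < R" for k
    proof -
      show "norm (w k) \<le> r / 2"
        unfolding norm_w using r by (intro divide_left_mono) auto
      then show "norm (w k) < R" using r by simp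
      show "w k \<noteq> 0" using r norm_w[of k] by auto
    qed
    define g where "g k v = (F (z(i := v, j := w k)) -
        (\<Sum>m<n. taylor_coeff F j m (z(i := v)) * w k ^ m)) / w k ^ n" for k v
    have hol: "g k holomorphic_on ball 0 R" for k
    proof -
      have "(\<lambda>v. F ((z(j := w k))(i := v))) holomorphic_on ball 0 R"
        using z w i by (intro sep_holomorphic_slice[OF F] polydisc_upd) auto
      then have "(\<lambda>v. F (z(i := v, j := w k))) holomorphic_on ball 0 R"
        using \<open>i \<noteq> j\<close> by (simp add: fun_upd_twist)
      moreover have "(\<lambda>v. taylor_coeff F j m (z(i := v))) holomorphic_on ball 0 R" if "m < n" for m
        by (rule sep_holomorphic_slice[OF less[OF that] z i])
      ultimately show ?thesis
        unfolding g_def using w by (intro holomorphic_intros) auto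
    qed
    \<comment> \<open>The bound does not involve \<open>v\<close>, which gives uniform convergence
      on the slice.\<close>
    have err: "norm (g k v - taylor_coeff F j n (z(i := v))) \<le> 2 * M / r ^ Suc n * norm (w k)"
      if "v \<in> ball 0 R" for k v
    proof -
      have zv: "z(i := v) \<in> polydisc R" using z that by (simp add: polydisc_upd)
      show ?thesis
        unfolding g_def taylor_coeff_def using r w zv
        by (intro power_series_remainder_le[of _ R])
           (auto intro: sep_holomorphic_slice[OF F] bound polydisc_upd)
    qed
    have "(\<lambda>k. 2 * M / r ^ Suc n * (r / (real k + 2))) \<longlonglongrightarrow> 0"
      by real_asymp
    then have lim0: "(\<lambda>k. 2 * M / r ^ Suc n * norm (w k)) \<longlonglongrightarrow> 0"
      by (simp add: norm_w)
    have ulim: "uniform_limit (ball 0 R) g (\<lambda>v. taylor_coeff F j n (z(i := v))) sequentially"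
    proof (rule uniform_limitI)
      fix e :: real assume "e > 0"
      then have "\<forall>\<^sub>F k in sequentially. 2 * M / r ^ Suc n * norm (w k) < e"
        by (rule order_tendstoD(2)[OF lim0])
      then show "\<forall>\<^sub>F k in sequentially. \<forall>v\<in>ball 0 R. dist (g k v) (taylor_coeff F j n (z(i := v))) < e"
        by eventually_elim (auto simp only: dist_norm intro: le_less_trans[OF err])
    qed
    show "(\<lambda>v. taylor_coeff F j n (z(i := v))) holomorphic_on ball 0 R"
    proof (rule holomorphic_uniform_sequence[OF open_ball hol])
      fix x :: complex assume "x \<in> ball 0 R"
      then obtain d where "0 < d" "cball x d \<subseteq> ball 0 R"
        by (metis open_contains_cball open_ball)
      then show "\<exists>d>0. cball x d \<subseteq> ball 0 R \<and>
          uniform_limit (cball x d) g (\<lambda>v. taylor_coeff F j n (z(i := v))) sequentially"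
        using uniform_limit_on_subset[OF ulim] by blast
    qed
  qed
qed

text \<open>Induction on \<open>I\<close>: expand in one coordinate \<open>j\<close>. Cauchy bounds
  the n-th coefficient by \<open>M / r ^ n\<close>, while multiplication by the n-th power of the
  character costs at most \<open>C * Q ^ n\<close>. As \<open>Q < r\<close>, the geometric sum
  contributes one factor \<open>C / (1 - Q / r)\<close> per variable.\<close>

lemma dser_le_sep_holomorphic:
  fixes \<omega> :: "nat \<times> nat \<Rightarrow> real"
  assumes w: "is_weight \<omega>" and "finite I" "I \<subseteq> N2"
    and C: "\<And>i k. i \<in> I \<Longrightarrow> \<omega> (npow i k) \<le> C * Q ^ k"
    and R: "0 < Q" "Q < r" "r < R" "1 < R"
    and F: "sep_holomorphic R I F" "\<And>z. z \<in> polydisc R \<Longrightarrow> norm (F z) \<le> M"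
      "\<And>z z'. (\<And>i. i \<in> I \<Longrightarrow> z i = z' i) \<Longrightarrow> F z = F z'"
  shows "dser_le \<omega> (M * \<omega> (1, 1) * (C / (1 - Q / r)) ^ card I) (\<lambda>s. F (dchar s))"
  using \<open>finite I\<close> \<open>I \<subseteq> N2\<close> C F
proof (induction I arbitrary: F M rule: finite_induct)
  case empty
  have F: "F z = F (\<lambda>_. 0)" for z by (rule empty.prems) auto
  have "norm (F (\<lambda>_. 0)) \<le> M"
    using R by (intro empty.prems) (auto simp: polydisc_def)
  then have "norm (F (\<lambda>_. 0)) * \<omega> (1, 1) \<le> M * \<omega> (1, 1)"
    using weight_ge_1[OF w, of "(1, 1)"] by (intro mult_right_mono) (auto simp: N2_def)
  then have "dser_le \<omega> (M * \<omega> (1, 1)) (\<lambda>s. F (\<lambda>_. 0))"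
    using dser_le_const[OF w] by (rule dser_le_mono[rotated])
  moreover have "(\<lambda>s. F (dchar s)) = (\<lambda>s. F (\<lambda>_. 0))" by (intro ext F)
  ultimately show ?case by simp
next
  case (insert j I)
  define B where "B = \<omega> (1, 1) * (C / (1 - Q / r)) ^ card I"
  have jN: "j \<in> N2" and IN: "I \<subseteq> N2" using insert.prems(1) by auto
  \<comment> \<open>The growth bound at exponent 0 forces \<open>C\<close> to be at least 1.\<close>
  have "1 \<le> \<omega> (npow j 0)"
    using weight_ge_1[OF w npow_in_N2[OF jN]] .
  also have "\<dots> \<le> C * Q ^ 0" by (rule insert.prems) simp
  finally have C1: "1 \<le> C" by simp
  have w1: "1 \<le> \<omega> (1, 1)" using weight_ge_1[OF w] by (auto simp: N2_def)
  have Qr: "0 < Q / r" "Q / r < 1" using R by (auto simp: field_simps)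
  have "norm (F (\<lambda>_. 0)) \<le> M"
    using R by (intro insert.prems(4)) (auto simp: polydisc_def)
  then have M0: "0 \<le> M" by (rule order_trans[OF norm_ge_zero])
  have B0: "0 \<le> B" using w1 C1 Qr by (auto simp: B_def)
  let ?c = "taylor_coeff F j"
  have slice: "(\<lambda>w. F (z(j := w))) holomorphic_on ball 0 R" if "z \<in> polydisc R" for z
    using insert.prems(3) that by (rule sep_holomorphic_slice) simp
  have bnd: "norm (F (z(j := w))) \<le> M" if "z \<in> polydisc R" "w \<in> ball 0 R" for z w
    using that by (intro insert.prems polydisc_upd) auto
  have coeff: "dser_le \<omega> (M / r ^ n * \<omega> (1, 1) * (C / (1 - Q / r)) ^ card I) (\<lambda>s. ?c n (dchar s))" for n
  proof (rule insert.IH)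
    show "sep_holomorphic R I (?c n)"
      by (rule sep_holomorphic_taylor_coeff[of R j I F M r]) (use insert.hyps(2) insert.prems(3,4) R in auto)
    show "norm (?c n z) \<le> M / r ^ n" if "z \<in> polydisc R" for z
      unfolding taylor_coeff_def using R by (intro norm_deriv_coeff_le[of _ _ R] slice bnd that) auto
    show "?c n z = ?c n z'" if "\<And>i. i \<in> I \<Longrightarrow> z i = z' i" for z z'
    proof -
      have "(\<lambda>w. F (z(j := w))) = (\<lambda>w. F (z'(j := w)))"
        by (intro ext insert.prems) (use that in auto)
      then show ?thesis by (simp add: taylor_coeff_def)
    qed
  qed (use IN insert.prems(2) in auto)
  define K where "K = (\<lambda>n. C * (M * B) * (Q / r) ^ n)"
  have summand: "dser_le \<omega> (K n) (\<lambda>s. dchar s (npow j n) * ?c n (dchar s))" for n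
  proof (rule dser_le_mono)
    show "dser_le \<omega> (\<omega> (npow j n) * (M / r ^ n * B)) (\<lambda>s. dchar s (npow j n) * ?c n (dchar s))"
      using dser_le_dchar_mult[OF w coeff npow_in_N2[OF jN], of n n] by (simp add: B_def mult_ac)
    have "\<omega> (npow j n) * (M / r ^ n * B) \<le> (C * Q ^ n) * (M / r ^ n * B)"
      using M0 B0 R by (intro mult_right_mono insert.prems) auto
    then show "\<omega> (npow j n) * (M / r ^ n * B) \<le> K n"
      by (simp add: K_def power_divide mult_ac)
  qed
  have "(\<lambda>n. (Q / r) ^ n) sums (1 / (1 - Q / r))"
    using Qr by (intro geometric_sums) auto
  from sums_mult[OF this, of "C * (M * B)"] have Ks: "K sums (C * (M * B) / (1 - Q / r))"
    by (simp add: K_def)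
  have K0: "0 \<le> K n" for n using C1 M0 B0 Qr by (simp add: K_def)
  have Khs: "(K has_sum (C * (M * B) / (1 - Q / r))) UNIV"
    using Ks by (rule sums_nonneg_imp_has_sum) (use K0 in auto)
  have "dser_le \<omega> (infsum K UNIV) (\<lambda>s. \<Sum>\<^sub>\<infinity>n. dchar s (npow j n) * ?c n (dchar s))"
    by (rule dser_le_infsum[OF w summand]) (use Khs in \<open>auto simp: summable_on_def\<close>)
  moreover have "infsum K UNIV = M * \<omega> (1, 1) * (C / (1 - Q / r)) ^ card (insert j I)"
    using infsumI[OF Khs] insert.hyps by (simp add: B_def mult_ac)
  moreover have "(\<Sum>\<^sub>\<infinity>n. dchar s (npow j n) * ?c n (dchar s)) = F (dchar s)"
    if s: "s \<in> Hplane \<times> Hplane" for s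
  proof (rule infsumI, rule norm_summable_imp_has_sum)
    show "summable (\<lambda>n. norm (dchar s (npow j n) * ?c n (dchar s)))"
      by (rule summable_comparison_test[of _ K])
         (use norm_dser_le[OF w summand s] sums_summable[OF Ks] in auto)
    \<comment> \<open>As \<open>1 < R\<close>, every \<open>dchar s\<close> lies in the polydisc;
      the Taylor series in coordinate \<open>j\<close>, evaluated at the coordinate's own value,
      returns \<open>F (dchar s)\<close>.\<close>
    have 1: "norm (dchar s x) < R" for x using norm_dchar_le_1[OF s, of x] R by simp
    then have "(\<lambda>n. ?c n (dchar s) * (dchar s j - 0) ^ n) sums F ((dchar s)(j := dchar s j))"
      unfolding taylor_coeff_def
      by (intro holomorphic_power_series[of "\<lambda>w. F ((dchar s)(j := w))" 0 R] slice) (auto simp: polydisc_def)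
    then show "(\<lambda>n. dchar s (npow j n) * ?c n (dchar s)) sums F (dchar s)"
      by (simp add: dchar_npow mult.commute)
  qed
  ultimately show ?case
    by (subst dser_le_cong[of _ "\<lambda>s. \<Sum>\<^sub>\<infinity>n. dchar s (npow j n) * ?c n (dchar s)"]) auto
qed

section \<open>Dirichlet polynomials and Kronecker approximation\<close>

text \<open>Lipschitz continuity in the sup norm over \<open>I\<close>, with \<open>d\<close>
  replacing a maximum of coordinate distances.\<close>

definition lip_const :: "'i set \<Rightarrow> real \<Rightarrow> real \<Rightarrow> (('i \<Rightarrow> complex) \<Rightarrow> complex) \<Rightarrow> bool" where
  "lip_const I B L P \<longleftrightarrow> (\<forall>z w d. 0 \<le> d \<longrightarrow>
     (\<forall>i\<in>I. norm (z i) \<le> B \<and> norm (w i) \<le> B \<and> norm (z i - w i) \<le> d) \<longrightarrow> norm (P z - P w) \<le> L * d)"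

definition lip_on :: "'i set \<Rightarrow> (('i \<Rightarrow> complex) \<Rightarrow> complex) \<Rightarrow> bool" where
  "lip_on I P \<longleftrightarrow> (\<forall>B\<ge>0. \<exists>L\<ge>0. lip_const I B L P)"

lemma lip_constD:
  assumes "lip_const I B L P" "0 \<le> d" "\<And>i. i \<in> I \<Longrightarrow> norm (z i) \<le> B"
    "\<And>i. i \<in> I \<Longrightarrow> norm (w i) \<le> B" "\<And>i. i \<in> I \<Longrightarrow> norm (z i - w i) \<le> d"
  shows "norm (P z - P w) \<le> L * d"
  using assms by (simp add: lip_const_def)

lemma lip_onE:
  assumes "lip_on I P" "0 \<le> B"
  obtains L where "0 \<le> L" "lip_const I B L P"
  using assms unfolding lip_on_def by blast

text \<open>The Lipschitz estimate at \<open>d = 0\<close>, with \<open>B\<close> a common bound for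
  the finitely many coordinates.\<close>

lemma lip_on_imp_eq:
  assumes "lip_on I P" "finite I" "\<And>i. i \<in> I \<Longrightarrow> z i = w i"
  shows "P z = P w"
proof -
  define B where "B = (\<Sum>i\<in>I. norm (w i))"
  have B: "norm (w i) \<le> B" if "i \<in> I" for i
    unfolding B_def using assms(2) that by (intro member_le_sum) auto
  have "0 \<le> B" by (auto simp: B_def sum_nonneg)
  then obtain L where L: "lip_const I B L P"
    using lip_onE[OF assms(1)] by blast
  have "norm (P z - P w) \<le> L * 0"
    using B assms(3) by (intro lip_constD[OF L]) auto
  then show ?thesis by simp
qed

lemma lip_on_const: "lip_on I (\<lambda>z. c)"
  unfolding lip_on_def lip_const_def by (auto intro!: exI[of _ 0])

lemma lip_on_coord: "i \<in> I \<Longrightarrow> lip_on I (\<lambda>z. z i)"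
  unfolding lip_on_def lip_const_def by (auto intro!: exI[of _ 1])

lemma lip_on_add:
  assumes "lip_on I P" "lip_on I Q"
  shows "lip_on I (\<lambda>z. P z + Q z)"
  unfolding lip_on_def
proof (intro allI impI)
  fix B :: real assume B: "0 \<le> B"
  obtain L where L: "0 \<le> L" "lip_const I B L P"
    by (rule lip_onE[OF assms(1) B])
  obtain L' where L': "0 \<le> L'" "lip_const I B L' Q"
    by (rule lip_onE[OF assms(2) B])
  have "norm (P z + Q z - (P w + Q w)) \<le> (L + L') * d"
    if "0 \<le> d" "\<forall>i\<in>I. norm (z i) \<le> B \<and> norm (w i) \<le> B \<and> norm (z i - w i) \<le> d" for z w d
  proof -
    have "norm (P z - P w) \<le> L * d" "norm (Q z - Q w) \<le> L' * d"
      using that by (auto intro!: lip_constD[OF L(2)] lip_constD[OF L'(2)])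
    moreover have "norm (P z + Q z - (P w + Q w)) \<le> norm (P z - P w) + norm (Q z - Q w)"
      by (metis add_diff_add norm_triangle_ineq)
    ultimately show ?thesis by (simp add: algebra_simps)
  qed
  then show "\<exists>L\<ge>0. lip_const I B L (\<lambda>z. P z + Q z)"
    unfolding lip_const_def using L(1) L'(1) by (intro exI[of _ "L + L'"]) auto
qed

lemma lip_on_mult:
  assumes "lip_on I P" "lip_on I Q"
  shows "lip_on I (\<lambda>z. P z * Q z)"
  unfolding lip_on_def
proof (intro allI impI)
  fix B :: real assume B: "0 \<le> B"
  obtain L where L: "0 \<le> L" "lip_const I B L P"
    by (rule lip_onE[OF assms(1) B])
  obtain L' where L': "0 \<le> L'" "lip_const I B L' Q"
    by (rule lip_onE[OF assms(2) B])
  \<comment> \<open>\<open>M\<close> and \<open>M'\<close> bound the two factors on the polydisc of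
    radius \<open>B\<close> by comparison with the origin.\<close>
  define M where "M = norm (P (\<lambda>_. 0)) + L * B"
  define M' where "M' = norm (Q (\<lambda>_. 0)) + L' * B"
  have M: "norm (P z) \<le> M" "norm (Q z) \<le> M'" if "\<And>i. i \<in> I \<Longrightarrow> norm (z i) \<le> B" for z
  proof -
    have "norm (P z - P (\<lambda>_. 0)) \<le> L * B" "norm (Q z - Q (\<lambda>_. 0)) \<le> L' * B"
      using that B by (auto intro!: lip_constD[OF L(2)] lip_constD[OF L'(2)])
    then show "norm (P z) \<le> M" "norm (Q z) \<le> M'"
      unfolding M_def M'_def
      using norm_triangle_sub[of "P z" "P (\<lambda>_. 0)"] norm_triangle_sub[of "Q z" "Q (\<lambda>_. 0)"] by linarith+
  qed
  have M0: "0 \<le> M" "0 \<le> M'" using B L(1) L'(1) by (auto simp: M_def M'_def)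
  have "norm (P z * Q z - P w * Q w) \<le> (M * L' + M' * L) * d"
    if "0 \<le> d" "\<forall>i\<in>I. norm (z i) \<le> B \<and> norm (w i) \<le> B \<and> norm (z i - w i) \<le> d" for z w d
  proof -
    have 1: "norm (P z - P w) \<le> L * d" "norm (Q z - Q w) \<le> L' * d"
      using that by (auto intro!: lip_constD[OF L(2)] lip_constD[OF L'(2)])
    have "norm (P z * Q z - P w * Q w) = norm (P z * (Q z - Q w) + (P z - P w) * Q w)"
      by (simp add: algebra_simps)
    also have "\<dots> \<le> norm (P z) * norm (Q z - Q w) + norm (P z - P w) * norm (Q w)"
      by (metis norm_triangle_ineq norm_mult)
    also have "\<dots> \<le> M * (L' * d) + (L * d) * M'"
      using that 1 M0 L(1) by (intro add_mono mult_mono M) auto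
    finally show ?thesis by (simp add: algebra_simps)
  qed
  then show "\<exists>L\<ge>0. lip_const I B L (\<lambda>z. P z * Q z)"
    unfolding lip_const_def using L(1) L'(1) M0 by (intro exI[of _ "M * L' + M' * L"]) auto
qed

lemma lip_on_power: "lip_on I P \<Longrightarrow> lip_on I (\<lambda>z. P z ^ n)"
  by (induction n) (auto intro: lip_on_const lip_on_mult)

lemma lip_on_sum: "(\<And>x. x \<in> S \<Longrightarrow> lip_on I (P x)) \<Longrightarrow> lip_on I (\<lambda>z. \<Sum>x\<in>S. P x z)"
  by (induction S rule: infinite_finite_induct) (auto intro: lip_on_const lip_on_add)

lemma lip_on_prod: "(\<And>x. x \<in> S \<Longrightarrow> lip_on I (P x)) \<Longrightarrow> lip_on I (\<lambda>z. \<Prod>x\<in>S. P x z)"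
  by (induction S rule: infinite_finite_induct) (auto intro: lip_on_const lip_on_mult)

section \<open>Bohr's correspondence\<close>

text \<open>By unique factorization these freely generate N^2; they index the variables of Bohr's
  correspondence.\<close>

definition prime_gens :: "(nat \<times> nat) set" where
  "prime_gens = {(p, 1) |p. prime p} \<union> {(1, p) |p. prime p}"

definition gens_of :: "nat \<times> nat \<Rightarrow> (nat \<times> nat) set" where
  "gens_of x = (\<lambda>p. (p, 1)) ` prime_factors (fst x) \<union> (\<lambda>p. (1, p)) ` prime_factors (snd x)"

text \<open>The multiplicative extension to N^2 of the values of \<open>z\<close> at the prime
  generators.\<close>

definition monomial :: "(nat \<times> nat \<Rightarrow> complex) \<Rightarrow> nat \<times> nat \<Rightarrow> complex" where
  "monomial z x = (\<Prod>p\<in>prime_factors (fst x). z (p, 1) ^ multiplicity p (fst x)) *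
              (\<Prod>p\<in>prime_factors (snd x). z (1, p) ^ multiplicity p (snd x))"

definition dpoly :: "(nat \<times> nat) set \<Rightarrow> (nat \<times> nat \<Rightarrow> complex) \<Rightarrow> (nat \<times> nat \<Rightarrow> complex) \<Rightarrow> complex" where
  "dpoly S a z = (\<Sum>x\<in>S. a x * monomial z x)"

lemma gens_of_subset: "gens_of x \<subseteq> prime_gens"
  by (auto simp: gens_of_def prime_gens_def)

lemma finite_gens_of: "finite (gens_of x)"
  by (auto simp: gens_of_def)

lemma prime_gens_subset_N2: "prime_gens \<subseteq> N2"
  by (auto simp: prime_gens_def N2_def prime_gt_0_nat)

lemma lip_on_dpoly:
  assumes "\<And>x. x \<in> S \<Longrightarrow> gens_of x \<subseteq> I"
  shows "lip_on I (dpoly S a)"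
proof -
  have "(p, 1) \<in> I" if "x \<in> S" "p \<in> prime_factors (fst x)" for x p
    using assms[OF that(1)] that(2) unfolding gens_of_def by blast
  moreover have "(1, p) \<in> I" if "x \<in> S" "p \<in> prime_factors (snd x)" for x p
    using assms[OF that(1)] that(2) unfolding gens_of_def by blast
  ultimately show ?thesis
    unfolding dpoly_def monomial_def
    by (intro lip_on_sum lip_on_mult lip_on_const lip_on_prod lip_on_power lip_on_coord)
qed

lemma holomorphic_on_fun_upd_coord: "(\<lambda>w. (z(i := w)) j) holomorphic_on A"
  by (cases "i = j") (auto intro: holomorphic_intros)

lemma holomorphic_on_dpoly_slice: "(\<lambda>w. dpoly S a (z(i := w))) holomorphic_on A"
  unfolding dpoly_def monomial_def
  by (intro holomorphic_intros holomorphic_on_prod holomorphic_on_fun_upd_coord)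

lemma of_nat_prod_power_powr:
  "(of_nat (\<Prod>p\<in>A. p ^ k p) :: complex) powr s = (\<Prod>p\<in>A. (of_nat p powr s) ^ k p)"
proof -
  have pow: "(of_nat (p ^ n) :: complex) powr s = (of_nat p powr s) ^ n" for p n :: nat
    by (induction n) (simp_all only: power_Suc of_nat_mult_powr_complex, simp)
  show ?thesis
    by (induction A rule: infinite_finite_induct)
       (simp_all add: of_nat_mult_powr_complex pow del: of_nat_mult of_nat_power of_nat_prod)
qed

text \<open>Characters are completely multiplicative, so the prime factorization reassembles. Hence,
  for \<open>S\<close> inside \<open>N2\<close>, \<open>dpoly S a\<close> at \<open>dchar s\<close>
  is the Dirichlet polynomial with coefficients \<open>a\<close>.\<close>

lemma monomial_dchar:
  assumes "x \<in> N2"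
  shows "monomial (dchar s) x = dchar s x"
proof -
  have "(\<Prod>p\<in>prime_factors n. ((of_nat p :: complex) powr t) ^ multiplicity p n) = of_nat n powr t"
    if "n > 0" for n :: nat and t
    using of_nat_prod_power_powr[of "\<lambda>p. multiplicity p n" "prime_factors n" t]
    by (simp only: prime_factorization_nat[OF that, symmetric])
  with assms show ?thesis by (auto simp: monomial_def dchar_def N2_def)
qed

section \<open>Kronecker's theorem for logarithms of primes\<close>

text \<open>Moving negative exponents to the other side and exponentiating gives two equal products
  of prime powers, so unique factorization decides.\<close>

lemma sum_ln_primes_eq_0:
  assumes "finite A" "\<And>p. p \<in> A \<Longrightarrow> prime (p :: nat)" "(\<Sum>p\<in>A. of_int (k p) * ln (real p)) = 0" "q \<in> A"
  shows "k q = 0"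
proof -
  have ln_prod': "ln (real (\<Prod>p\<in>A. p ^ e p)) = (\<Sum>p\<in>A. real (e p) * ln (real p))" for e :: "nat \<Rightarrow> nat"
  proof -
    have pos: "0 < real p" if "p \<in> A" for p using prime_gt_0_nat[OF assms(2)[OF that]] by simp
    have "ln (real (\<Prod>p\<in>A. p ^ e p)) = (\<Sum>p\<in>A. ln (real p ^ e p))"
      unfolding of_nat_prod of_nat_power using assms(1) pos by (intro ln_prod) auto
    also have "\<dots> = (\<Sum>p\<in>A. real (e p) * ln (real p))"
      using pos by (intro sum.cong refl ln_realpow)
    finally show ?thesis .
  qed
  have "real_of_int m = real (nat m) - real (nat (- m))" for m by (cases "0 \<le> m") auto
  then have "(\<Sum>p\<in>A. of_int (k p) * ln (real p)) = (\<Sum>p\<in>A. (real (nat (k p)) - real (nat (- k p))) * ln (real p))"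
    by (intro sum.cong refl arg_cong2[where f = "(*)"])
  then have "(\<Sum>p\<in>A. real (nat (k p)) * ln (real p)) = (\<Sum>p\<in>A. real (nat (- k p)) * ln (real p))"
    unfolding assms(3) left_diff_distrib sum_subtractf by simp
  then have "ln (real (\<Prod>p\<in>A. p ^ nat (k p))) = ln (real (\<Prod>p\<in>A. p ^ nat (- k p)))"
    unfolding ln_prod' .
  moreover have "0 < (\<Prod>p\<in>A. p ^ e p)" for e :: "nat \<Rightarrow> nat"
    using assms(2) by (intro prod_pos) (auto simp: prime_gt_0_nat)
  ultimately have "real (\<Prod>p\<in>A. p ^ nat (k p)) = real (\<Prod>p\<in>A. p ^ nat (- k p))"
    by (subst (asm) ln_inj_iff) (simp_all only: of_nat_0_less_iff)
  then have "(\<Prod>p\<in>A. p ^ nat (k p)) = (\<Prod>p\<in>A. p ^ nat (- k p))"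
    by (simp only: of_nat_eq_iff)
  \<comment> \<open>At most one of these two truncations is nonzero, so equality makes both
    vanish.\<close>
  then have "nat (k q) = nat (- k q)"
    using multiplicity_prod_prime_powers[of A q "\<lambda>p. nat (k p)"]
      multiplicity_prod_prime_powers[of A q "\<lambda>p. nat (- k p)"] assms by simp
  then show ?thesis by linarith
qed

lemma norm_cis_diff_le: "norm (cis x - cis y) \<le> \<bar>x - y\<bar>"
proof -
  have "cis x = cis y * cis (x - y)" by (simp add: cis_mult)
  then have "cis x - cis y = cis y * (cis (x - y) - 1)" by (simp add: right_diff_distrib)
  then have "cis x - cis y = cis y * (exp (\<i> * of_real (x - y)) - 1)"
    by (simp only: cis_conv_exp[of "x - y"])
  then have "norm (cis x - cis y) = 2 * \<bar>sin ((x - y) / 2)\<bar>"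
    by (simp only: norm_mult norm_cis dist_exp_i_1)
  also have "\<dots> \<le> \<bar>x - y\<bar>"
    using abs_sin_x_le_abs_x[of "(x - y) / 2"] by simp
  finally show ?thesis .
qed

text \<open>The logarithms of distinct primes are linearly independent over the integers, so the
  flow taking t to the family of p^(-it) is dense in the torus.\<close>

lemma kronecker_primes:
  assumes "finite A" "\<And>p. p \<in> A \<Longrightarrow> prime (p :: nat)" "\<And>p. p \<in> A \<Longrightarrow> norm (u p) = 1" "e > 0"
  obtains t where "\<And>p. p \<in> A \<Longrightarrow> norm (cis (- t * ln (real p)) - u p) < e"
proof -
  obtain h where h: "bij_betw h {..<card A} A"
    using ex_bij_betw_nat_finite[OF assms(1)] by (auto simp: atLeast0LessThan)
  \<comment> \<open>Dividing by \<open>2 * pi\<close> measures phases in full turns, matching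
    approximation modulo 1 in Kronecker's theorem.\<close>
  define l where "l p = ln (real p) / (2 * pi)" for p :: nat
  have inj: "inj_on l A"
    using assms(2) by (auto simp: l_def inj_on_def prime_gt_0_nat)
  \<comment> \<open>With integer scalars acting on the reals, \<open>independent\<close> means
    linear independence over the integers.\<close>
  interpret Modules.module "(\<lambda>r. (*) (real_of_int r))"
    by (simp add: Modules.module.intro distrib_left mult.commute)
  have "independent (l ` A)"
    unfolding independent_explicit_module
  proof (intro allI impI)
    fix T u v assume T: "finite T" "T \<subseteq> l ` A" "(\<Sum>v\<in>T. real_of_int (u v) * v) = 0" "v \<in> T"
    then obtain A' where A': "A' \<subseteq> A" "T = l ` A'"
      by (meson subset_imageE)
    then obtain q where q: "q \<in> A'" "v = l q" using T by blast
    have "0 = (\<Sum>p\<in>A'. real_of_int (u (l p)) * l p)"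
      using T(3) A' inj inj_on_subset[OF inj A'(1)] by (simp add: sum.reindex)
    also have "\<dots> = (\<Sum>p\<in>A'. real_of_int (u (l p)) * ln (real p)) / (2 * pi)"
      by (simp add: l_def sum_divide_distrib)
    finally have "(\<Sum>p\<in>A'. real_of_int (u (l p)) * ln (real p)) = 0" by simp
    then show "u v = 0"
      using sum_ln_primes_eq_0[of A' "\<lambda>p. u (l p)" q] A' q assms finite_subset by blast
  qed
  then have indep: "independent ((l \<circ> h) ` {..<card A})"
    using h unfolding bij_betw_def by (metis image_comp)
  have injh: "inj_on (l \<circ> h) {..<card A}"
    using h inj by (auto simp: bij_betw_def intro: comp_inj_on)
  have e': "e / (2 * pi) > 0" using assms by simp
  \<comment> \<open>The targets carry a minus sign because the flow is
    \<open>cis (- t * ln (real p))\<close>; the tolerance \<open>e\<close> is converted to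
    turns.\<close>
  obtain t m where t: "\<And>i. i < card A \<Longrightarrow>
      \<bar>t * (l \<circ> h) i - of_int (m i) - (- Arg (u (h i)) / (2 * pi))\<bar> < e / (2 * pi)"
    using Kronecker_thm_1[OF indep injh e', where \<alpha> = "\<lambda>i. - Arg (u (h i)) / (2 * pi)"] by metis
  show thesis
  proof (rule that[of t])
    fix p assume "p \<in> A"
    then obtain i where i: "i < card A" "p = h i" using h by (auto simp: bij_betw_def)
    have "cis (- t * ln (real p)) = cis (- t * ln (real p) + 2 * pi * of_int (m i))"
      by (metis cis_mult cis_multiple_2pi Ints_of_int mult.right_neutral)
    moreover have "u p \<noteq> 0" using assms(3)[OF \<open>p \<in> A\<close>] by auto
    then have "u p = cis (Arg (u p))"
      using cis_Arg[of "u p"] assms(3)[OF \<open>p \<in> A\<close>] by (simp add: sgn_eq)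
    ultimately have "norm (cis (- t * ln (real p)) - u p)
        = norm (cis (- t * ln (real p) + 2 * pi * of_int (m i)) - cis (Arg (u p)))"
      by simp
    also have "\<dots> \<le> \<bar>- t * ln (real p) + 2 * pi * of_int (m i) - Arg (u p)\<bar>"
      by (rule norm_cis_diff_le)
    also have "\<dots> = 2 * pi * \<bar>t * (l \<circ> h) i - of_int (m i) - (- Arg (u (h i)) / (2 * pi))\<bar>"
    proof -
      have "- t * ln (real p) + 2 * pi * of_int (m i) - Arg (u p)
        = - (2 * pi) * (t * (l \<circ> h) i - of_int (m i) - (- Arg (u (h i)) / (2 * pi)))"
        by (simp add: i l_def field_simps)
      then show ?thesis by (simp only: abs_mult) simp
    qed
    also have "\<dots> < e"
      using t[OF i(1)] by (simp add: field_simps)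
    finally show "norm (cis (- t * ln (real p)) - u p) < e" .
  qed
qed

section \<open>Lower bounds on the closed polydisc\<close>

text \<open>\<open>J\<close> holds the coordinates pinned to their boundary circles. Since
  \<open>G\<close> has no zeros, the maximum modulus principle for \<open>1 / G\<close> frees them
  one at a time without loss in \<open>k\<close>.\<close>

lemma polydisc_min_modulus:
  fixes G :: "('i \<Rightarrow> complex) \<Rightarrow> complex" and \<rho> :: "'i \<Rightarrow> real"
  assumes "finite J" "J \<subseteq> I" and \<rho>: "\<And>i. i \<in> I \<Longrightarrow> 0 < \<rho> i" and "0 < k"
    and hol: "\<And>z i. (\<lambda>w. G (z(i := w))) holomorphic_on UNIV"
    and nz: "\<And>z. (\<And>i. i \<in> I \<Longrightarrow> norm (z i) \<le> \<rho> i) \<Longrightarrow> G z \<noteq> 0"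
    and torus: "\<And>z. (\<And>i. i \<in> I \<Longrightarrow> norm (z i) \<le> \<rho> i) \<Longrightarrow> (\<And>i. i \<in> J \<Longrightarrow> norm (z i) = \<rho> i) \<Longrightarrow> k \<le> norm (G z)"
    and z: "\<And>i. i \<in> I \<Longrightarrow> norm (z i) \<le> \<rho> i"
  shows "k \<le> norm (G z)"
  using assms(1,2) torus z
proof (induction J arbitrary: z rule: finite_induct)
  case empty
  show ?case using empty.prems(3) by (intro empty.prems(2)) auto
next
  case (insert j J)
  \<comment> \<open>Frees coordinate \<open>j\<close>: the boundary hypothesis for
    \<open>insert j J\<close> yields the one for \<open>J\<close>.\<close>
  have low: "k \<le> norm (G z)" if z: "\<And>i. i \<in> I \<Longrightarrow> norm (z i) \<le> \<rho> i" "\<And>i. i \<in> J \<Longrightarrow> norm (z i) = \<rho> i" for z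
  proof -
    let ?h = "\<lambda>w. 1 / G (z(j := w))"
    have jI: "j \<in> I" using insert.prems(1) by auto
    have nzw: "G (z(j := w)) \<noteq> 0" if "w \<in> cball 0 (\<rho> j)" for w
      using that z by (intro nz) auto
    have hol': "(\<lambda>w. G (z(j := w))) holomorphic_on T" for T
      using hol by (rule holomorphic_on_subset) auto
    have "norm (?h (z j)) \<le> 1 / k"
    proof (rule maximum_modulus_frontier[of ?h "cball 0 (\<rho> j)"])
      show "?h holomorphic_on interior (cball 0 (\<rho> j))"
        using nzw by (intro holomorphic_intros hol') auto
      show "continuous_on (closure (cball 0 (\<rho> j))) ?h"
        using nzw by (intro continuous_intros holomorphic_on_imp_continuous_on hol') auto
      show "norm (?h w) \<le> 1 / k" if "w \<in> frontier (cball 0 (\<rho> j))" for w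
      proof -
        have "norm w = \<rho> j" using that \<rho>[OF jI] by simp
        then have "k \<le> norm (G (z(j := w)))"
          using z by (intro insert.prems(2)) auto
        then show ?thesis using \<open>0 < k\<close> by (simp add: norm_divide frac_le)
      qed
    qed (use z jI in auto)
    moreover have "0 < norm (G z)" using nz[OF z(1)] by simp
    ultimately show ?thesis
      using \<open>0 < k\<close> by (simp add: norm_divide field_simps)
  qed
  show ?case
    by (rule insert.IH[OF _ low insert.prems(3)]) (use insert.prems(1) in auto)
qed

section \<open>Polydiscs with radii p^(-\<sigma>)\<close>

text \<open>At a prime generator the product is the prime itself, so this is the modulus of
  \<open>dchar s i\<close> when both entries of \<open>s\<close> have real part \<sigma>.\<close>

definition gen_radius :: "real \<Rightarrow> nat \<times> nat \<Rightarrow> real" where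
  "gen_radius \<sigma> i = real (fst i * snd i) powr (- \<sigma>)"

lemma gen_radius_pos: "i \<in> prime_gens \<Longrightarrow> 0 < gen_radius \<sigma> i"
  by (auto simp: prime_gens_def gen_radius_def prime_gt_0_nat)

lemma gen_radius_add: "gen_radius (\<sigma> + \<tau>) i = gen_radius \<sigma> i * gen_radius \<tau> i"
  by (simp add: gen_radius_def flip: powr_add)

lemma gen_radius_le_2: 
  assumes "i \<in> prime_gens" "0 \<le> \<sigma>" shows "gen_radius \<sigma> i \<le> 2 powr (- \<sigma>)"
proof -
  have "2 \<le> fst i * snd i" using assms(1) by (auto simp: prime_gens_def prime_ge_2_nat)
  then have "2 \<le> real (fst i * snd i)" by linarith
  then show ?thesis using assms(2) unfolding gen_radius_def by (intro powr_mono2') auto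
qed

lemma gen_radius_le_1: "i \<in> prime_gens \<Longrightarrow> 0 \<le> \<sigma> \<Longrightarrow> gen_radius \<sigma> i \<le> 1"
  using gen_radius_le_2[of i \<sigma>] powr_mono[of "- \<sigma>" 0 "2 :: real"] by force

lemma gen_radius_tendsto_1:
  assumes "i \<in> prime_gens"
  shows "((\<lambda>\<sigma>. gen_radius \<sigma> i) \<longlongrightarrow> 1) (at_right 0)"
proof -
  define q where "q = real (fst i * snd i)"
  have q: "0 < q" using assms by (auto simp: q_def prime_gens_def prime_gt_0_nat)
  then have "((\<lambda>\<sigma>. q powr (- \<sigma>)) \<longlongrightarrow> q powr (- 0)) (at_right 0)"
    by (intro tendsto_intros) auto
  then show ?thesis using q unfolding gen_radius_def q_def[symmetric] by simp
qed

lemma of_nat_powr_vertical: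
  assumes "(p :: nat) > 0"
  shows "(of_nat p :: complex) powr (- Complex \<sigma> t) = of_real (real p powr (- \<sigma>)) * cis (- t * ln (real p))"
proof -
  have "(of_nat p :: complex) powr (- Complex \<sigma> t) = exp (- Complex \<sigma> t * of_real (ln (real p)))"
    using assms by (simp add: powr_def Ln_of_nat)
  also have "\<dots> = of_real (exp (- \<sigma> * ln (real p))) * cis (- t * ln (real p))"
    by (subst exp_eq_polar) simp
  finally show ?thesis using assms by (simp add: powr_def)
qed

text \<open>The points \<open>dchar s\<close> with both real parts equal to \<sigma> are dense in
  this torus: the two imaginary parts vary independently, so Kronecker's theorem serves the primes
  of each coordinate separately. Continuity of \<open>G\<close> carries the bound over.\<close>

lemma torus_lower_bound:
  assumes I: "finite I" "I \<subseteq> prime_gens" and G: "lip_on I G" and "0 \<le> \<sigma>"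
    and bound: "\<And>s. s \<in> Hplane \<times> Hplane \<Longrightarrow> k \<le> norm (G (dchar s))"
    and z: "\<And>i. i \<in> I \<Longrightarrow> norm (z i) = gen_radius \<sigma> i"
  shows "k \<le> norm (G z)"
proof -
  obtain L where L: "0 \<le> L" "lip_const I 1 L G" by (rule lip_onE[OF G zero_le_one])
  define A where "A = {p. (p, 1) \<in> I}"
  define A' where "A' = {p. (1, p) \<in> I}"
  have "A \<subseteq> fst ` I" "A' \<subseteq> snd ` I" by (force simp: A_def A'_def)+
  then have fin: "finite A" "finite A'" using I by (auto intro: finite_subset)
  have prime: "prime p" if "p \<in> A \<union> A'" for p
    using that I by (auto simp: A_def A'_def prime_gens_def)
  \<comment> \<open>The phases of \<open>z\<close>, which the vertical flow has to
    approximate.\<close>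
  define u where "u i = z i / of_real (gen_radius \<sigma> i)" for i
  have u: "norm (u i) = 1" "z i = of_real (gen_radius \<sigma> i) * u i" if "i \<in> I" for i
    using gen_radius_pos[of i \<sigma>] z[OF that] that I by (auto simp: u_def norm_divide)
  have approx: "k - L * e \<le> norm (G z)" if "e > 0" for e
  proof -
    obtain t where t: "\<And>p. p \<in> A \<Longrightarrow> norm (cis (- t * ln (real p)) - u (p, 1)) < e"
      by (rule kronecker_primes[of A "\<lambda>p. u (p, 1)" e]) (use fin prime u \<open>e > 0\<close> in \<open>auto simp: A_def\<close>)
    obtain t' where t': "\<And>p. p \<in> A' \<Longrightarrow> norm (cis (- t' * ln (real p)) - u (1, p)) < e"
      by (rule kronecker_primes[of A' "\<lambda>p. u (1, p)" e]) (use fin prime u \<open>e > 0\<close> in \<open>auto simp: A'_def\<close>)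
    define s where "s = (Complex \<sigma> t, Complex \<sigma> t')"
    have s: "s \<in> Hplane \<times> Hplane" using \<open>0 \<le> \<sigma>\<close> by (simp add: s_def Hplane_def)
    have close: "norm (dchar s i - z i) \<le> e" if i: "i \<in> I" for i
    proof -
      have "\<exists>c. dchar s i = of_real (gen_radius \<sigma> i) * c \<and> norm (c - u i) < e"
      proof -
        consider p where "i = (p, 1)" "p \<in> A" | p where "i = (1, p)" "p \<in> A'"
          using i I by (auto simp: A_def A'_def prime_gens_def)
        then show ?thesis
        proof cases
          case 1
          then have "dchar s i = of_real (gen_radius \<sigma> i) * cis (- t * ln (real p))"
            using prime[of p] of_nat_powr_vertical[of p \<sigma> t]
            by (simp add: dchar_def s_def gen_radius_def prime_gt_0_nat)
          with t[OF 1(2)] 1 show ?thesis by blast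
        next
          case 2
          then have "dchar s i = of_real (gen_radius \<sigma> i) * cis (- t' * ln (real p))"
            using prime[of p] of_nat_powr_vertical[of p \<sigma> t']
            by (simp add: dchar_def s_def gen_radius_def prime_gt_0_nat)
          with t'[OF 2(2)] 2 show ?thesis by blast
        qed
      qed
      then obtain c where c: "dchar s i = of_real (gen_radius \<sigma> i) * c" "norm (c - u i) < e" by blast
      have "0 < gen_radius \<sigma> i" using gen_radius_pos i I by blast
      then have "norm (dchar s i - z i) = gen_radius \<sigma> i * norm (c - u i)"
        using u(2)[OF i] c by (simp add: norm_mult flip: right_diff_distrib)
      also have "\<dots> \<le> 1 * norm (c - u i)"
        using gen_radius_le_1[of i \<sigma>] i I \<open>0 \<le> \<sigma>\<close> by (intro mult_right_mono) auto
      finally show ?thesis using c by simp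
    qed
    have "norm (G (dchar s) - G z) \<le> L * e"
      using close \<open>e > 0\<close> norm_dchar_le_1[OF s] z gen_radius_le_1[OF _ \<open>0 \<le> \<sigma>\<close>] I
      by (intro lip_constD[OF L(2)]) auto
    then show ?thesis
      using bound[OF s] norm_triangle_ineq2[of "G (dchar s)" "G z"] by linarith
  qed
  \<comment> \<open>Letting \<open>e\<close> tend to 0 removes the loss
    \<open>L * e\<close>.\<close>
  have "((\<lambda>e. k - L * e) \<longlongrightarrow> k - L * 0) (at_right 0)"
    by (intro tendsto_intros)
  then have "k - L * 0 \<le> norm (G z)"
  proof (rule tendsto_upperbound)
    show "\<forall>\<^sub>F e in at_right 0. k - L * e \<le> norm (G z)"
      using eventually_at_right_less[of 0] by eventually_elim (rule approx)
  qed simp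
  then show ?thesis by simp
qed

text \<open>The zero-free polydiscs with radii \<open>p\<close> to the power \<open>-\<sigma>\<close> are enlarged by letting \<open>\<sigma>\<close> descend
  to \<open>0\<close>: on a zero-free polydisc the minimum modulus is attained on the distinguished boundary,
  so the lower bound \<open>k\<close> never deteriorates and the Lipschitz bound yields a uniform step size.\<close>

lemma polydisc_lower_bound:
  assumes I: "finite I" "I \<subseteq> prime_gens" and G: "lip_on I G" and "0 < k"
    and hol: "\<And>z i. (\<lambda>w. G (z(i := w))) holomorphic_on UNIV"
    and bound: "\<And>s. s \<in> Hplane \<times> Hplane \<Longrightarrow> k \<le> norm (G (dchar s))"
    and z: "\<And>i. i \<in> I \<Longrightarrow> norm (z i) \<le> 1"
  shows "k \<le> norm (G z)"
proof -
  obtain L where L: "0 \<le> L" "lip_const I 1 L G" by (rule lip_onE[OF G zero_le_one])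
  define good where "good \<sigma> \<longleftrightarrow> (\<forall>z. (\<forall>i\<in>I. norm (z i :: complex) \<le> gen_radius \<sigma> i) \<longrightarrow> k \<le> norm (G z))" for \<sigma>
  \<comment> \<open>Absence of zeros on the polydisc already gives the bound \<open>k\<close>,
    through the torus and the minimum modulus principle.\<close>
  have upgrade: "good \<sigma>"
    if "0 \<le> \<sigma>" and nz: "\<And>z. (\<And>i. i \<in> I \<Longrightarrow> norm (z i) \<le> gen_radius \<sigma> i) \<Longrightarrow> G z \<noteq> 0" for \<sigma>
    unfolding good_def
  proof (intro allI impI)
    fix z :: "nat \<times> nat \<Rightarrow> complex" assume "\<forall>i\<in>I. norm (z i) \<le> gen_radius \<sigma> i"
    then show "k \<le> norm (G z)"
      using I gen_radius_pos \<open>0 < k\<close> hol nz torus_lower_bound[OF I G \<open>0 \<le> \<sigma>\<close> bound]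
      by (intro polydisc_min_modulus[of I I "gen_radius \<sigma>" k G z]) auto
  qed
  have le1: "gen_radius \<sigma> i \<le> 1" if "i \<in> I" "0 \<le> \<sigma>" for i \<sigma>
    using gen_radius_le_1 that I by blast
  \<comment> \<open>All primes are at least 2, so for large \<sigma> the polydisc is so small that
    \<open>G\<close> varies by less than \<open>k\<close> on it.\<close>
  have "((\<lambda>\<sigma>. 2 * (L * 2 powr (- \<sigma>))) \<longlongrightarrow> 0) at_top" by real_asymp
  from order_tendstoD(2)[OF this \<open>0 < k\<close>]
  obtain \<sigma>0 where \<sigma>0: "\<And>\<sigma>. \<sigma> \<ge> \<sigma>0 \<Longrightarrow> 2 * (L * 2 powr (- \<sigma>)) < k"
    by (auto simp: eventually_at_top_linorder)
  have start: "good \<sigma>" if \<sigma>: "\<sigma> \<ge> max 0 \<sigma>0" for \<sigma>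
  proof (rule upgrade)
    fix z :: "nat \<times> nat \<Rightarrow> complex" assume z: "\<And>i. i \<in> I \<Longrightarrow> norm (z i) \<le> gen_radius \<sigma> i"
    have r2: "gen_radius \<sigma> i \<le> 2 powr (- \<sigma>)" "0 < gen_radius \<sigma> i" if "i \<in> I" for i
      using gen_radius_le_2[of i \<sigma>] gen_radius_pos[of i \<sigma>] that I \<sigma> by auto
    define z1 :: "nat \<times> nat \<Rightarrow> complex" where "z1 i = of_real (gen_radius \<sigma> i)" for i
    have n1: "norm (z1 i) = gen_radius \<sigma> i" if "i \<in> I" for i
      using r2(2)[OF that] by (simp add: z1_def)
    have "k \<le> norm (G z1)"
      using \<sigma> n1 by (intro torus_lower_bound[OF I G _ bound]) auto
    moreover have "norm (G z1 - G z) \<le> L * (2 * 2 powr (- \<sigma>))"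
    proof (rule lip_constD[OF L(2)])
      show "norm (z1 i) \<le> 1" "norm (z i) \<le> 1" if "i \<in> I" for i
        using n1[OF that] z[OF that] le1[OF that, of \<sigma>] \<sigma> by auto
      show "norm (z1 i - z i) \<le> 2 * 2 powr (- \<sigma>)" if "i \<in> I" for i
        using norm_triangle_ineq4[of "z1 i" "z i"] n1[OF that] z[OF that] r2(1)[OF that] by linarith
    qed simp
    ultimately have "0 < norm (G z)"
      using \<sigma>0[of \<sigma>] \<sigma> norm_triangle_ineq2[of "G z1" "G z"] by auto
    then show "G z \<noteq> 0" by simp
  qed (use \<sigma> in auto)
  \<comment> \<open>With such \<eta>, multiplication by \<open>gen_radius \<eta> i\<close> moves
    points of the unit disc by at most \<open>k / (2 * (L + 1))\<close>, so \<open>G\<close> changes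
    by less than \<open>k\<close>. The summand 1 guards against \<open>L = 0\<close>.\<close>
  have "\<forall>\<^sub>F \<eta> in at_right 0. \<forall>i\<in>I. 1 - k / (2 * (L + 1)) < gen_radius \<eta> i"
  proof (rule eventually_ball_finite[OF I(1)], rule ballI)
    fix i assume "i \<in> I"
    then show "\<forall>\<^sub>F \<eta> in at_right 0. 1 - k / (2 * (L + 1)) < gen_radius \<eta> i"
      using \<open>0 < k\<close> L(1) I by (intro order_tendstoD(1)[OF gen_radius_tendsto_1]) auto
  qed
  then have "\<forall>\<^sub>F \<eta> in at_right 0. (\<forall>i\<in>I. 1 - k / (2 * (L + 1)) < gen_radius \<eta> i) \<and> 0 < \<eta>"
    by (intro eventually_conj eventually_at_right_less)
  then obtain \<eta> where \<eta>: "0 < \<eta>" "\<And>i. i \<in> I \<Longrightarrow> 1 - k / (2 * (L + 1)) < gen_radius \<eta> i"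
    using eventually_happens' trivial_limit_at_right_real by blast
  have step: "good (real n * \<eta>)" if "good (real (Suc n) * \<eta>)" for n
  proof (rule upgrade)
    fix z :: "nat \<times> nat \<Rightarrow> complex" assume z: "\<And>i. i \<in> I \<Longrightarrow> norm (z i) \<le> gen_radius (real n * \<eta>) i"
    \<comment> \<open>Shrinks \<open>z\<close> into the smaller polydisc, where the bound
      \<open>k\<close> is already known.\<close>
    define z1 where "z1 i = z i * of_real (gen_radius \<eta> i)" for i
    have pos: "0 < gen_radius \<eta> i" if "i \<in> I" for i using gen_radius_pos that I by blast
    have n1: "norm (z1 i) \<le> gen_radius (real (Suc n) * \<eta>) i" if "i \<in> I" for i
    proof -
      have "norm (z1 i) = norm (z i) * gen_radius \<eta> i" using pos[OF that] by (simp add: z1_def norm_mult)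
      also have "\<dots> \<le> gen_radius (real n * \<eta>) i * gen_radius \<eta> i"
        using z[OF that] pos[OF that] by (intro mult_right_mono) auto
      also have "\<dots> = gen_radius (real (Suc n) * \<eta>) i"
        by (simp add: algebra_simps flip: gen_radius_add)
      finally show ?thesis .
    qed
    then have "k \<le> norm (G z1)" using that unfolding good_def by blast
    moreover have "norm (G z1 - G z) \<le> L * (k / (2 * (L + 1)))"
    proof (rule lip_constD[OF L(2)])
      show "0 \<le> k / (2 * (L + 1))" using L(1) \<open>0 < k\<close> by simp
      show nz1: "norm (z i) \<le> 1" if "i \<in> I" for i
        using z[OF that] le1[OF that, of "real n * \<eta>"] \<eta>(1) by auto
      show "norm (z1 i) \<le> 1" if "i \<in> I" for i
        using n1[OF that] le1[OF that, of "real (Suc n) * \<eta>"] \<eta>(1) by auto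
      show "norm (z1 i - z i) \<le> k / (2 * (L + 1))" if "i \<in> I" for i
      proof -
        have "z1 i - z i = - (z i * of_real (1 - gen_radius \<eta> i))"
          by (simp add: z1_def algebra_simps)
        then have "norm (z1 i - z i) = norm (z i) * \<bar>1 - gen_radius \<eta> i\<bar>"
          by (simp only: norm_minus_cancel norm_mult norm_of_real)
        also have "\<dots> \<le> 1 * \<bar>1 - gen_radius \<eta> i\<bar>"
          using nz1[OF that] by (intro mult_right_mono) auto
        also have "\<dots> \<le> k / (2 * (L + 1))"
          using \<eta>(2)[OF that] le1[OF that, of \<eta>] \<eta>(1) by auto
        finally show ?thesis .
      qed
    qed
    moreover have "L * (k / (2 * (L + 1))) < k"
      using L(1) \<open>0 < k\<close> by (simp add: field_simps add_nonneg_pos)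
    ultimately have "0 < norm (G z)"
      using norm_triangle_ineq2[of "G z1" "G z"] by auto
    then show "G z \<noteq> 0" by simp
  qed (use \<eta> in auto)
  \<comment> \<open>Finitely many steps of length \<eta> lead from an exponent at least
    \<open>max 0 \<sigma>0\<close> down to 0, where all radii are 1.\<close>
  obtain N :: nat where N: "max 0 \<sigma>0 / \<eta> \<le> real N" using real_arch_simple by blast
  have "good (real (N - n) * \<eta>)" if "n \<le> N" for n
    using that
  proof (induction n)
    case 0
    show ?case using N \<eta>(1) by (intro start) (simp add: field_simps)
  next
    case (Suc n)
    then have "good (real (Suc (N - Suc n)) * \<eta>)" by (simp add: Suc_diff_Suc)
    then show ?case by (rule step)
  qed
  from this[of N] have "good 0" by simp
  moreover have "gen_radius 0 i = 1" if "i \<in> I" for i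
    using that I by (auto simp: gen_radius_def prime_gens_def prime_gt_0_nat)
  ultimately show ?thesis using z by (simp add: good_def)
qed

section \<open>Holomorphic functional calculus\<close>

lemma admissible_weight_growth:
  assumes "admissible_weight \<omega>" "x \<in> N2" "1 < Q"
  shows "\<exists>C\<ge>0. \<forall>k. \<omega> (npow x k) \<le> C * Q ^ k"
proof -
  have w: "is_weight \<omega>" using assms by (simp add: admissible_weight_def)
  have w1: "1 \<le> \<omega> (npow x k)" for k using weight_ge_1[OF w npow_in_N2[OF assms(2)]] .
  have "(\<lambda>n. \<omega> (npow x n) powr (1 / real n)) \<longlonglongrightarrow> 1"
    using assms by (cases x) (auto simp: admissible_weight_def npow_def)
  from order_tendstoD(2)[OF this assms(3)]
  obtain N where N: "\<And>n. n \<ge> N \<Longrightarrow> \<omega> (npow x n) powr (1 / real n) < Q"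
    by (auto simp: eventually_sequentially)
  \<comment> \<open>The sum absorbs exponents up to \<open>N\<close>; beyond \<open>N\<close> the
    weight is at most \<open>Q ^ k\<close>, which the summand 1 covers.\<close>
  define C where "C = 1 + (\<Sum>n\<le>N. \<omega> (npow x n))"
  have sum0: "0 \<le> (\<Sum>n\<le>N. \<omega> (npow x n))"
    using w1 by (intro sum_nonneg) (auto intro: order_trans[OF zero_le_one])
  then have C: "1 \<le> C" by (simp add: C_def)
  have "\<omega> (npow x k) \<le> C * Q ^ k" for k
  proof (cases "k \<le> N")
    case True
    have "\<omega> (npow x k) \<le> (\<Sum>n\<le>N. \<omega> (npow x n))"
      using True w1 by (intro member_le_sum) (auto intro: order_trans[OF zero_le_one])
    also have "\<dots> \<le> C * 1" by (simp add: C_def)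
    also have "\<dots> \<le> C * Q ^ k" using C assms(3) by (intro mult_left_mono) auto
    finally show ?thesis .
  next
    case False
    have "\<omega> (npow x k) = (\<omega> (npow x k) powr (1 / real k)) powr real k"
      using False w1[of k] by (simp add: powr_powr)
    also have "\<dots> \<le> Q powr real k"
      using N[of k] False by (intro powr_mono2) auto
    also have "\<dots> = 1 * Q ^ k" using assms(3) by (simp add: powr_realpow)
    also have "\<dots> \<le> C * Q ^ k" using C assms(3) by (intro mult_right_mono) auto
    finally show ?thesis .
  qed
  then show ?thesis using C by (intro exI[of _ C]) auto
qed

lemma admissible_weight_uniform_growth:
  assumes "admissible_weight \<omega>" "finite I" "I \<subseteq> N2" "1 < Q"
  obtains C where "\<And>x k. x \<in> I \<Longrightarrow> \<omega> (npow x k) \<le> C * Q ^ k"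
proof -
  have "\<forall>x\<in>I. \<exists>C\<ge>0. \<forall>k. \<omega> (npow x k) \<le> C * Q ^ k"
    using admissible_weight_growth assms by blast
  then obtain C where C: "\<And>x. x \<in> I \<Longrightarrow> 0 \<le> C x" "\<And>x k. x \<in> I \<Longrightarrow> \<omega> (npow x k) \<le> C x * Q ^ k"
    by metis
  show thesis
  proof (rule that[of "sum C I"])
    fix x k assume x: "x \<in> I"
    have "C x \<le> sum C I" using x C assms by (intro member_le_sum) auto
    then have "C x * Q ^ k \<le> sum C I * Q ^ k" using assms by (intro mult_right_mono) auto
    with C(2)[OF x, of k] show "\<omega> (npow x k) \<le> sum C I * Q ^ k" by linarith
  qed
qed

section \<open>Approximation by Dirichlet polynomials\<close>

text \<open>Truncate to a finite set carrying all but \<rho> of the weighted norm;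
  \<open>monomial_dchar\<close> identifies the truncated sum with \<open>dpoly\<close>.\<close>

lemma dirichlet_polynomial_approximation:
  assumes w: "is_weight \<omega>" and f: "has_weighted_dirichlet \<omega> f" and "\<rho> > 0"
  obtains S a where "finite S" "S \<subseteq> N2" "dser_le \<omega> \<rho> (\<lambda>s. f s - dpoly S a (dchar s))"
proof -
  obtain a where a: "(\<lambda>x. norm (a x) * \<omega> x) summable_on N2"
    "\<And>s. s \<in> Hplane \<times> Hplane \<Longrightarrow> f s = (\<Sum>\<^sub>\<infinity>x\<in>N2. a x * dchar s x)"
    using f unfolding has_weighted_dirichlet_iff dser_le_def by blast
  obtain S where S: "finite S" "S \<subseteq> N2"
    "dist (\<Sum>x\<in>S. norm (a x) * \<omega> x) (\<Sum>\<^sub>\<infinity>x\<in>N2. norm (a x) * \<omega> x) \<le> \<rho>"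
    using infsum_finite_approximation[OF a(1) \<open>\<rho> > 0\<close>] by blast
  define b where "b x = (if x \<in> S then 0 else a x)" for x
  have sumS: "g summable_on S" for g :: "nat \<times> nat \<Rightarrow> 'b :: {comm_monoid_add, t2_space}"
    using S(1) by simp
  have tail: "(\<lambda>x. norm (b x) * \<omega> x) summable_on N2 \<longleftrightarrow> (\<lambda>x. norm (a x) * \<omega> x) summable_on (N2 - S)"
    "(\<Sum>\<^sub>\<infinity>x\<in>N2. norm (b x) * \<omega> x) = (\<Sum>\<^sub>\<infinity>x\<in>N2 - S. norm (a x) * \<omega> x)"
    by (intro summable_on_cong_neutral infsum_cong_neutral; auto simp: b_def)+
  have "dser_le \<omega> \<rho> (\<lambda>s. f s - dpoly S a (dchar s))"
    unfolding dser_le_def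
  proof (intro exI[of _ b] conjI ballI)
    show "(\<lambda>x. norm (b x) * \<omega> x) summable_on N2"
      unfolding tail using a(1) by (rule summable_on_subset_banach) auto
    show "(\<Sum>\<^sub>\<infinity>x\<in>N2. norm (b x) * \<omega> x) \<le> \<rho>"
      using S(3) unfolding tail(2) infsum_Diff[OF a(1) sumS S(2)] infsum_finite[OF S(1)] dist_real_def
      by linarith
    fix s assume s: "s \<in> Hplane \<times> Hplane"
    have sum: "(\<lambda>x. a x * dchar s x) summable_on N2"
      by (rule abs_summable_summable[OF abs_summable_dchar[OF weighted_summable_imp_abs_summable[OF w a(1)] s]])
    have "(\<Sum>\<^sub>\<infinity>x\<in>N2. b x * dchar s x) = (\<Sum>\<^sub>\<infinity>x\<in>N2 - S. a x * dchar s x)"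
      by (intro infsum_cong_neutral) (auto simp: b_def)
    also have "\<dots> = f s - (\<Sum>x\<in>S. a x * dchar s x)"
      unfolding infsum_Diff[OF sum sumS S(2)] infsum_finite[OF S(1)] a(2)[OF s] ..
    also have "(\<Sum>x\<in>S. a x * dchar s x) = dpoly S a (dchar s)"
      unfolding dpoly_def using S(2) by (intro sum.cong) (auto simp: monomial_dchar)
    finally show "f s - dpoly S a (dchar s) = (\<Sum>\<^sub>\<infinity>x\<in>N2. b x * dchar s x)" ..
  qed
  with S show thesis by (intro that) auto
qed

text \<open>If the value at \<open>z\<close> had distance \<open>D\<close> greater than \<rho>, the
  function sending \<open>v\<close> to the difference of the values at \<open>z\<close> and
  \<open>v\<close> would be at least \<open>D - \<rho>\<close> in modulus at all characters, hence
  on the closed polydisc; but it vanishes at \<open>v = z\<close>.\<close>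

lemma infdist_dpoly_le:
  assumes I: "finite I" "I \<subseteq> prime_gens" and G: "\<And>x. x \<in> S \<Longrightarrow> gens_of x \<subseteq> I"
    and f: "\<And>s. s \<in> Hplane \<times> Hplane \<Longrightarrow> norm (f s - dpoly S a (dchar s)) \<le> \<rho>"
    and z: "\<And>i. i \<in> I \<Longrightarrow> norm (z i) \<le> 1"
  shows "infdist (dpoly S a z) (closure (f ` (Hplane \<times> Hplane))) \<le> \<rho>"
proof (rule ccontr)
  define D where "D = infdist (dpoly S a z) (closure (f ` (Hplane \<times> Hplane)))"
  assume "\<not> ?thesis"
  then have pos: "0 < D - \<rho>" by (simp add: D_def)
  \<comment> \<open>The difference is written with \<open>+ - 1 *\<close> to match the closure rules
    for \<open>lip_on\<close>.\<close>
  have "D - \<rho> \<le> norm (dpoly S a z + - 1 * dpoly S a z)"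
  proof (rule polydisc_lower_bound[OF I, where G = "\<lambda>v. dpoly S a z + - 1 * dpoly S a v"])
    show "lip_on I (\<lambda>v. dpoly S a z + - 1 * dpoly S a v)"
      by (intro lip_on_add lip_on_mult lip_on_const lip_on_dpoly G)
    show "(\<lambda>w. dpoly S a z + - 1 * dpoly S a (v(i := w))) holomorphic_on UNIV" for v i
      by (intro holomorphic_intros holomorphic_on_dpoly_slice)
    fix s assume s: "s \<in> Hplane \<times> Hplane"
    then have "D \<le> dist (dpoly S a z) (f s)"
      unfolding D_def by (intro infdist_le closure_subset[THEN subsetD]) auto
    also have "\<dots> \<le> norm (dpoly S a z - dpoly S a (dchar s)) + norm (f s - dpoly S a (dchar s))"
      using norm_triangle_ineq4[of "dpoly S a z - dpoly S a (dchar s)" "f s - dpoly S a (dchar s)"]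
      by (simp add: dist_norm)
    finally show "D - \<rho> \<le> norm (dpoly S a z + - 1 * dpoly S a (dchar s))"
      using f[OF s] by simp
  qed (use z pos in auto)
  with pos show False by simp
qed

section \<open>Composition with a holomorphic function\<close>

lemma has_weighted_dirichlet_holomorphic_compose:
  assumes adm: "admissible_weight \<omega>" and f: "has_weighted_dirichlet \<omega> f"
    and U: "open U" "closure (f ` (Hplane \<times> Hplane)) \<subseteq> U" and \<phi>: "\<phi> holomorphic_on U"
  shows "has_weighted_dirichlet \<omega> (\<phi> \<circ> f)"
proof -
  have w: "is_weight \<omega>" using adm by (simp add: admissible_weight_def)
  define Y where "Y = closure (f ` (Hplane \<times> Hplane))"
  obtain K0 where K0: "dser_le \<omega> K0 f" using f has_weighted_dirichlet_iff by blast
  have "bounded (f ` (Hplane \<times> Hplane))"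
    using norm_dser_le[OF w K0] by (auto simp: bounded_iff)
  then have Y: "compact Y" by (simp add: Y_def compact_closure)
  have "(0, 0) \<in> Hplane \<times> Hplane" by (simp add: Hplane_def)
  then have Yne: "Y \<noteq> {}" by (auto simp: Y_def)
  obtain e where e: "e > 0" "(\<Union>x\<in>Y. ball x e) \<subseteq> U"
    using compact_subset_open_imp_ball_epsilon_subset[OF Y U(1)] U(2) by (auto simp: Y_def)
  \<comment> \<open>Distance budget: values of the polynomial stay within \<rho> of \<open>Y\<close>
    on the closed unit polydisc and within \<open>2 * \<rho>\<close> on a larger one. Discs of
    radius \<open>3 * \<rho>\<close> around them remain within \<open>5 * \<rho> < e\<close>, hence
    in \<open>U\<close>.\<close>
  define \<rho> where "\<rho> = e / 6"
  have \<rho>: "\<rho> > 0" "5 * \<rho> < e" using e(1) by (auto simp: \<rho>_def)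
  define V where "V = {x. infdist x Y \<le> 5 * \<rho>}"
  have V: "compact V" unfolding V_def using Y Yne \<rho> by (intro compact_infdist_le) auto
  have VU: "V \<subseteq> U"
  proof
    fix x assume "x \<in> V"
    moreover obtain y where "y \<in> Y" "infdist x Y = dist x y"
      using infdist_attains_inf[OF compact_imp_closed[OF Y] Yne] by blast
    ultimately have "x \<in> ball y e" using \<rho> by (simp add: V_def dist_commute)
    with \<open>y \<in> Y\<close> e show "x \<in> U" by blast
  qed
  have "compact (\<phi> ` V)"
    using \<phi> V VU by (intro compact_continuous_image) (auto intro: holomorphic_on_imp_continuous_on holomorphic_on_subset)
  then obtain M where M: "\<And>v. v \<in> V \<Longrightarrow> norm (\<phi> v) \<le> M"
    using compact_imp_bounded bounded_iff by (metis imageI)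
  have ballV: "ball v (3 * \<rho>) \<subseteq> V" if "infdist v Y \<le> 2 * \<rho>" for v
  proof
    fix x assume "x \<in> ball v (3 * \<rho>)"
    then show "x \<in> V"
      using infdist_triangle[of x Y v] that by (simp add: V_def dist_commute)
  qed
  obtain S a where S: "finite S" "S \<subseteq> N2" and fP: "dser_le \<omega> \<rho> (\<lambda>s. f s - dpoly S a (dchar s))"
    using dirichlet_polynomial_approximation[OF w f \<rho>(1)] by blast
  define P where "P = dpoly S a"
  define I where "I = (\<Union>x\<in>S. gens_of x)"
  have I: "finite I" "I \<subseteq> prime_gens" "\<And>x. x \<in> S \<Longrightarrow> gens_of x \<subseteq> I"
    using S gens_of_subset finite_gens_of by (auto simp: I_def)
  have IN: "I \<subseteq> N2" using I(2) prime_gens_subset_N2 by blast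
  have lip: "lip_on I P" unfolding P_def by (intro lip_on_dpoly I)
  have fP_le: "norm (f s - P (dchar s)) \<le> \<rho>" if "s \<in> Hplane \<times> Hplane" for s
    using norm_dser_le[OF w fP that] by (simp add: P_def)
  have P1: "infdist (P z) Y \<le> \<rho>" if "\<And>i. i \<in> I \<Longrightarrow> norm (z i) \<le> 1" for z
    unfolding P_def Y_def using I fP_le that by (intro infdist_dpoly_le) (auto simp: P_def)
  have "(0::real) \<le> 2" by simp
  then obtain L where L: "0 \<le> L" "lip_const I 2 L P" by (rule lip_onE[OF lip])
  \<comment> \<open>Ensures \<open>L * \<epsilon> \<le> \<rho>\<close>, also for
    \<open>L = 0\<close>; the cap 1 keeps the enlarged polydisc within radius 2, where
    \<open>L\<close> is valid.\<close>
  define \<epsilon> where "\<epsilon> = min 1 (\<rho> / (L + 1))"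
  have \<epsilon>: "0 < \<epsilon>" "\<epsilon> \<le> 1" "\<epsilon> \<le> \<rho> / (L + 1)" using \<rho> L(1) by (auto simp: \<epsilon>_def)
  have "L * \<epsilon> \<le> (L + 1) * (\<rho> / (L + 1))" using \<epsilon> L(1) by (intro mult_mono) auto
  then have L\<epsilon>: "L * \<epsilon> \<le> \<rho>" using L(1) by simp
  have P2: "infdist (P z) Y \<le> 2 * \<rho>" if z: "z \<in> polydisc (1 + \<epsilon>)" for z
  proof -
    \<comment> \<open>Radial contraction into the closed unit polydisc, moving each coordinate by at
      most \<epsilon>.\<close>
    define z1 where "z1 i = z i / of_real (1 + \<epsilon>)" for i
    have n: "norm (z i) < 1 + \<epsilon>" for i using z unfolding polydisc_def by blast
    have n1: "norm (z1 i) \<le> 1" for i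
      using n[of i] \<epsilon> unfolding z1_def norm_divide norm_of_real by simp
    have "norm (P z - P z1) \<le> L * \<epsilon>"
    proof (rule lip_constD[OF L(2)])
      show "norm (z i) \<le> 2" "norm (z1 i) \<le> 2" for i
        using n[of i] n1[of i] \<epsilon> by auto
      show "norm (z i - z1 i) \<le> \<epsilon>" for i
      proof -
        have "of_real (1 + \<epsilon>) \<noteq> (0 :: complex)" using \<epsilon> unfolding of_real_eq_0_iff by linarith
        then have "z i = z1 i * of_real (1 + \<epsilon>)" unfolding z1_def by (rule nonzero_divide_eq_eq[THEN iffD1]) (rule refl)
        then have "z i - z1 i = z1 i * of_real \<epsilon>" by (simp only: of_real_add of_real_1 distrib_left mult_1_right add_diff_cancel_left')
        then have "norm (z i - z1 i) = norm (z1 i) * \<epsilon>" using \<epsilon> by (simp add: norm_mult)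
        also have "\<dots> \<le> 1 * \<epsilon>" using n1[of i] \<epsilon> by (intro mult_right_mono) auto
        finally show ?thesis by simp
      qed
    qed (use \<epsilon> in auto)
    then have "dist (P z) (P z1) \<le> \<rho>" using L\<epsilon> by (simp add: dist_norm)
    moreover have "infdist (P z1) Y \<le> \<rho>" by (rule P1) (rule n1)
    ultimately show ?thesis
      using infdist_triangle[of "P z" Y "P z1"] by linarith
  qed
  \<comment> \<open>Equally spaced radii: the weight grows with base
    \<open>1 + \<epsilon> / 3\<close>, Cauchy's estimate uses \<open>1 + 2 * \<epsilon> / 3\<close>,
    and holomorphy holds up to \<open>1 + \<epsilon>\<close>.\<close>
  obtain C where C: "\<And>x k. x \<in> I \<Longrightarrow> \<omega> (npow x k) \<le> C * (1 + \<epsilon> / 3) ^ k"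
    using admissible_weight_uniform_growth[OF adm I(1) IN, of "1 + \<epsilon> / 3"] \<epsilon> by auto
  define B where "B = \<omega> (1, 1) * (C / (1 - (1 + \<epsilon> / 3) / (1 + 2 * \<epsilon> / 3))) ^ card I"
  define c where "c n v = (deriv ^^ n) \<phi> v / fact n" for n v
  have coeff: "dser_le \<omega> (M / (2 * \<rho>) ^ n * B) (\<lambda>s. c n (P (dchar s)))" for n
    unfolding B_def mult.assoc[symmetric]
  proof (rule dser_le_sep_holomorphic[OF w I(1) IN C, where R = "1 + \<epsilon>" and F = "\<lambda>z. c n (P z)"])
    show "sep_holomorphic (1 + \<epsilon>) I (\<lambda>z. c n (P z))"
      unfolding sep_holomorphic_def
    proof (intro ballI)
      fix z :: "nat \<times> nat \<Rightarrow> complex" and i assume z: "z \<in> polydisc (1 + \<epsilon>)"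
      have "(c n \<circ> (\<lambda>w. P (z(i := w)))) holomorphic_on ball 0 (1 + \<epsilon>)"
      proof (rule holomorphic_on_compose_gen[where t = U])
        show "(\<lambda>w. P (z(i := w))) holomorphic_on ball 0 (1 + \<epsilon>)"
          unfolding P_def by (rule holomorphic_on_dpoly_slice)
        show "c n holomorphic_on U"
          unfolding c_def using \<phi> U(1) by (intro holomorphic_intros) auto
        show "(\<lambda>w. P (z(i := w))) ` ball 0 (1 + \<epsilon>) \<subseteq> U"
        proof safe
          fix w :: complex assume "w \<in> ball 0 (1 + \<epsilon>)"
          then have "infdist (P (z(i := w))) Y \<le> 2 * \<rho>"
            using z by (intro P2 polydisc_upd) auto
          then have "P (z(i := w)) \<in> V" using \<rho> by (simp add: V_def)
          then show "P (z(i := w)) \<in> U" using VU by blast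
        qed
      qed
      then show "(\<lambda>w. c n (P (z(i := w)))) holomorphic_on ball 0 (1 + \<epsilon>)" by (simp add: o_def)
    qed
    \<comment> \<open>Cauchy's estimate at radius \<open>2 * \<rho>\<close>, strictly inside the
      disc of radius \<open>3 * \<rho>\<close> on which \<open>M\<close> bounds \<phi>.\<close>
    show "norm (c n (P z)) \<le> M / (2 * \<rho>) ^ n" if "z \<in> polydisc (1 + \<epsilon>)" for z
      unfolding c_def using ballV[OF P2[OF that]] VU M \<rho>
      by (intro norm_deriv_coeff_le[where R = "3 * \<rho>"] holomorphic_on_subset[OF \<phi>]) auto
    show "c n (P z) = c n (P z')" if "\<And>i. i \<in> I \<Longrightarrow> z i = z' i" for z z'
      using lip_on_imp_eq[OF lip I(1) that] by simp
  qed (use \<epsilon> in auto)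
  \<comment> \<open>The power contributes \<rho>^n and the coefficient
    \<open>1 / (2 * \<rho>) ^ n\<close>, leaving \<open>(1 / 2) ^ n\<close>. The explicit
    \<open>\<omega> (1, 1)\<close> comes from the power; another is inside \<open>B\<close>.\<close>
  define T where "T = (\<lambda>n. M * B * \<omega> (1, 1) * (1 / 2) ^ n)"
  have summand: "dser_le \<omega> (T n) (\<lambda>s. c n (P (dchar s)) * (f s - P (dchar s)) ^ n)" for n
  proof -
    have "M / (2 * \<rho>) ^ n * B * (\<rho> ^ n * \<omega> (1, 1)) = T n"
      using \<rho> by (simp add: T_def field_simps power_mult_distrib)
    then show ?thesis
      using dser_le_mult[OF w coeff dser_le_power[OF w fP], of n n] by (simp add: P_def)
  qed
  have "summable T" unfolding T_def by (intro summable_mult summable_geometric) auto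
  moreover have T0: "0 \<le> T n" for n
    using norm_dser_le[OF w summand \<open>(0, 0) \<in> Hplane \<times> Hplane\<close>] norm_ge_zero order_trans by blast
  ultimately have Tsum: "T summable_on UNIV"
    by (intro summable_nonneg_imp_summable_on) auto
  have "dser_le \<omega> (infsum T UNIV) (\<lambda>s. \<Sum>\<^sub>\<infinity>n. c n (P (dchar s)) * (f s - P (dchar s)) ^ n)"
    by (rule dser_le_infsum[OF w summand Tsum])
  moreover have "(\<Sum>\<^sub>\<infinity>n. c n (P (dchar s)) * (f s - P (dchar s)) ^ n) = (\<phi> \<circ> f) s"
    if s: "s \<in> Hplane \<times> Hplane" for s
  proof (rule infsumI, rule norm_summable_imp_has_sum)
    show "summable (\<lambda>n. norm (c n (P (dchar s)) * (f s - P (dchar s)) ^ n))"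
      by (rule summable_comparison_test[of _ T])
         (use norm_dser_le[OF w summand s] \<open>summable T\<close> in auto)
    \<comment> \<open>\<open>f s\<close> is within \<rho> of \<open>P (dchar s)\<close>, hence
      inside the disc of radius \<open>3 * \<rho>\<close> where the Taylor series of \<phi>
      converges.\<close>
    have "infdist (P (dchar s)) Y \<le> 2 * \<rho>"
      using P1[of "dchar s"] norm_dchar_le_1[OF s] \<rho> by force
    then have "\<phi> holomorphic_on ball (P (dchar s)) (3 * \<rho>)"
      using ballV VU by (intro holomorphic_on_subset[OF \<phi>]) blast
    then show "(\<lambda>n. c n (P (dchar s)) * (f s - P (dchar s)) ^ n) sums (\<phi> \<circ> f) s"
      unfolding c_def o_def using fP_le[OF s] \<rho>
      by (intro holomorphic_power_series) (auto simp: dist_norm norm_minus_commute)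
  qed
  ultimately have "dser_le \<omega> (infsum T UNIV) (\<phi> \<circ> f)"
    by (subst dser_le_cong[of _ "\<lambda>s. \<Sum>\<^sub>\<infinity>n. c n (P (dchar s)) * (f s - P (dchar s)) ^ n"]) auto
  then show ?thesis using has_weighted_dirichlet_iff by blast
qed

theorem theorem1:
  fixes \<omega> :: "nat \<times> nat \<Rightarrow> real"
    and f :: "complex \<times> complex \<Rightarrow> complex"
  assumes am: "almost_monotone_weight \<omega>"
    and dir: "has_weighted_dirichlet \<omega> f"
  shows
    "((\<exists>k>0. \<forall>s\<in>Hplane \<times> Hplane. k \<le> norm (f s)) \<longrightarrow>
       (\<exists>\<nu>. almost_monotone_weight \<nu> \<and>
            (constant_weight \<nu> \<longleftrightarrow> constant_weight \<omega>) \<and>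
            (admissible_weight \<nu> \<longleftrightarrow> admissible_weight \<omega>) \<and>
            (\<forall>x\<in>N2. 1 \<le> \<nu> x \<and> \<nu> x \<le> \<omega> x) \<and>
            has_weighted_dirichlet \<nu> (\<lambda>s. 1 / f s)))
     \<and>
     (\<forall>(\<phi> :: complex \<Rightarrow> complex) U. open U \<longrightarrow> closure (f ` (Hplane \<times> Hplane)) \<subseteq> U \<longrightarrow>
        \<phi> holomorphic_on U \<longrightarrow>
       (\<exists>\<xi>. almost_monotone_weight \<xi> \<and>
            (constant_weight \<xi> \<longleftrightarrow> constant_weight \<omega>) \<and>
            (admissible_weight \<xi> \<longleftrightarrow> admissible_weight \<omega>) \<and>
            (\<forall>x\<in>N2. 1 \<le> \<xi> x \<and> \<xi> x \<le> \<omega> x) \<and>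
            has_weighted_dirichlet \<xi> (\<phi> \<circ> f)))"
proof -
  have adm: "admissible_weight \<omega>" using am by (rule almost_monotone_weight_imp_admissible)
  then have ge1: "\<forall>x\<in>N2. 1 \<le> \<omega> x \<and> \<omega> x \<le> \<omega> x"
    by (auto simp: admissible_weight_def is_weight_def)
  have "has_weighted_dirichlet \<omega> (\<lambda>s. 1 / f s)"
    if k: "k > 0" "\<forall>s\<in>Hplane \<times> Hplane. k \<le> norm (f s)" for k
  proof -
    \<comment> \<open>Closedness of this set keeps the closure of the range away from 0, so the
      reciprocal is holomorphic on the neighbourhood \<open>- {0}\<close>.\<close>
    have "closed {v :: complex. k \<le> norm v}" by (intro closed_Collect_le continuous_intros)
    moreover have "f ` (Hplane \<times> Hplane) \<subseteq> {v. k \<le> norm v}" using k by auto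
    ultimately have "closure (f ` (Hplane \<times> Hplane)) \<subseteq> {v. k \<le> norm v}" by (rule closure_minimal[rotated])
    then have "closure (f ` (Hplane \<times> Hplane)) \<subseteq> - {0}" using k by auto
    moreover have "(\<lambda>v :: complex. 1 / v) holomorphic_on - {0}" by (intro holomorphic_intros) auto
    ultimately have "has_weighted_dirichlet \<omega> ((\<lambda>v. 1 / v) \<circ> f)"
      by (intro has_weighted_dirichlet_holomorphic_compose[OF adm dir, of "- {0}"]) auto
    then show ?thesis by (simp add: o_def)
  qed
  moreover have "has_weighted_dirichlet \<omega> (\<phi> \<circ> f)"
    if "open U" "closure (f ` (Hplane \<times> Hplane)) \<subseteq> U" "\<phi> holomorphic_on U" for \<phi> U
    using has_weighted_dirichlet_holomorphic_compose[OF adm dir that] .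
  ultimately show ?thesis using am ge1 by blast
qed

end
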